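(* Let $n$ be a positive integer such that $\alpha(n-2)\ge 3$, and let $k=n-3$ and $d=(n-1)(2^{k+1}-2)+k$. Then $\beta(d)>n$, but $\dim QM_n^{d,*}\neq 0$.
   Context: For a nonnegative integer $t$, $\alpha(t)$ is the number of $1$'s in the binary expansion of $t$. For a positive integer $d$, $\beta(d)=\min\{s\in\mathbb{N} : d=(2^{i_1}-1)+\cdots+(2^{i_s}-1)\text{ for some } i_1,\dots,i_s\in\mathbb{N}\}$. The base field is $\mathbb{C}$. Let $$M_n=\mathbb{Z}/2[\tau,x_1,\dots,x_n,y_1,\dots,y_n]/(x_1^2+\tau y_1,\dots,x_n^2+\tau y_n),$$ bigraded by $\deg\tau=(0,1)$, $\deg x_i=(1,1)$, $\deg y_i=(2,1)$; this is the mod $2$ motivic cohomology of the classifying space of $(\mathbb{Z}/2)^n$. The mod $2$ motivic Steenrod algebra $\mathcal{A}^{*,*}$ contains $\mathbb{Z}/2[\tau]$ (acting on $M_n$ by multiplication) and is generated over it by $Q_0$ (of degree $(1,0)$) and $\wp^a$, $a\ge 1$ (of degree $(2a,a)$); $\wp^0$ is the identity. These operations act additively on $M_n$ by $Q_0(\tau)=0$, $\wp^a(\tau)=0$ for $a\ge1$; $Q_0(x_i)=y_i$, $\wp^a(x_i)=0$ for $a\ge 1$; $Q_0(y_i)=0$, $\wp^1(y_i)=y_i^2$, $\wp^a(y_i)=0$ for $a\ge2$; and the Cartan formulas $$Q_0(xy)=Q_0(x)y+xQ_0(y),\qquad \wp^a(xy)=\sum_{b=0}^a\wp^{a-b}(x)\wp^b(y)+\tau\sum_{b=0}^{a-1}Q_0\wp^{a-1-b}(x)\,Q_0\wp^b(y).$$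 $\mathcal{A}^{*,*}_+$ is the set of homogeneous elements of $\mathcal{A}^{*,*}$ whose first and second degrees have positive sum (so $\tau\in\mathcal{A}^{*,*}_+$), and $\mathcal{A}^{*,*}_+(M_n)$ is the $\mathbb{Z}/2$-subspace of $M_n$ spanned by all $ax$ with $a\in\mathcal{A}^{*,*}_+$, $x\in M_n$. $M_n^{d,*}$ is the subspace spanned by the elements of degree $(d,w)$ for all $w$, and $$QM_n^{d,*}=M_n^{d,*}/(\mathcal{A}^{*,*}_+(M_n)\cap M_n^{d,*}),$$ a vector space over $\mathbb{Z}/2$. *)

theory Defs
  imports
    "HOL-Library.Poly_Mapping"
    "HOL-Library.Z2"
    "HOL-Algebra.QuotRing"
    "Jordan_Normal_Form.VS_Connect"
begin

section \<open>The numerical functions\<close>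

definition alpha :: "nat \<Rightarrow> nat" where
  "alpha t = card {i. bit t i}"

definition beta :: "nat \<Rightarrow> nat" where
  "beta d = (LEAST s. \<exists>i :: nat \<Rightarrow> nat. d = (\<Sum>j = 1..s. 2 ^ i j - 1))"


section \<open>The ring $M_n$\<close>

datatype mvar = VTau | VX nat | VY nat

type_synonym mpoly = "(mvar \<Rightarrow>\<^sub>0 nat) \<Rightarrow>\<^sub>0 bit"

definition Var :: "mvar \<Rightarrow> mpoly" where
  "Var v = Poly_Mapping.single (Poly_Mapping.single v 1) 1"

definition mvars :: "nat \<Rightarrow> mvar set" where
  "mvars n = {VTau} \<union> VX ` {1..n} \<union> VY ` {1..n}"

definition polys :: "nat \<Rightarrow> mpoly set" where
  "polys n = {p. \<forall>m \<in> Poly_Mapping.keys p. Poly_Mapping.keys m \<subseteq> mvars n}"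

definition poly_ring :: "nat \<Rightarrow> mpoly ring" where
  "poly_ring n = class_ring \<lparr>carrier := polys n\<rparr>"

definition rel_ideal :: "nat \<Rightarrow> mpoly set" where
  "rel_ideal n =
     Idl\<^bsub>poly_ring n\<^esub> {Var (VX i) ^ 2 + Var VTau * Var (VY i) | i. i \<in> {1..n}}"

definition cls :: "nat \<Rightarrow> mpoly \<Rightarrow> mpoly set" where
  "cls n p = rel_ideal n +>\<^bsub>poly_ring n\<^esub> p"

text \<open>
  Scalars of $\mathbb{Z}/2$ act on $M_n$ through the constant polynomials.
\<close>

definition motivic_ring :: "nat \<Rightarrow> (bit, mpoly set) module" where
  "motivic_ring n =
     ring.extend (poly_ring n Quot rel_ideal n)
       (module.fields
         (\<lambda>c u. cls n (Poly_Mapping.single 0 c) \<otimes>\<^bsub>poly_ring n Quot rel_ideal n\<^esub> u))"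

abbreviation tau :: "nat \<Rightarrow> mpoly set" where
  "tau n \<equiv> cls n (Var VTau)"

abbreviation gen_x :: "nat \<Rightarrow> nat \<Rightarrow> mpoly set" where
  "gen_x n i \<equiv> cls n (Var (VX i))"

abbreviation gen_y :: "nat \<Rightarrow> nat \<Rightarrow> mpoly set" where
  "gen_y n i \<equiv> cls n (Var (VY i))"

fun var_bideg :: "mvar \<Rightarrow> nat \<times> nat" where
  "var_bideg VTau = (0, 1)"
| "var_bideg (VX i) = (1, 1)"
| "var_bideg (VY i) = (2, 1)"

definition mono_bideg :: "(mvar \<Rightarrow>\<^sub>0 nat) \<Rightarrow> nat \<times> nat" where
  "mono_bideg m =
     (\<Sum>v \<in> Poly_Mapping.keys m. Poly_Mapping.lookup m v * fst (var_bideg v),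
      \<Sum>v \<in> Poly_Mapping.keys m. Poly_Mapping.lookup m v * snd (var_bideg v))"

definition homog :: "nat \<Rightarrow> nat \<Rightarrow> nat \<Rightarrow> mpoly set set" where
  "homog n d w =
     cls n ` {p \<in> polys n. \<forall>m \<in> Poly_Mapping.keys p. mono_bideg m = (d, w)}"


section \<open>The action of the motivic Steenrod algebra\<close>

locale motivic_operations =
  fixes n :: nat
    and Q :: "mpoly set \<Rightarrow> mpoly set"
    and P :: "nat \<Rightarrow> mpoly set \<Rightarrow> mpoly set"
  assumes Q_closed: "u \<in> carrier (motivic_ring n) \<Longrightarrow> Q u \<in> carrier (motivic_ring n)"
    and P_closed: "u \<in> carrier (motivic_ring n) \<Longrightarrow> P a u \<in> carrier (motivic_ring n)"
    and Q_add: "\<lbrakk>u \<in> carrier (motivic_ring n); v \<in> carrier (motivic_ring n)\<rbrakk> \<Longrightarrow>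
        Q (u \<oplus>\<^bsub>motivic_ring n\<^esub> v) = Q u \<oplus>\<^bsub>motivic_ring n\<^esub> Q v"
    and P_add: "\<lbrakk>u \<in> carrier (motivic_ring n); v \<in> carrier (motivic_ring n)\<rbrakk> \<Longrightarrow>
        P a (u \<oplus>\<^bsub>motivic_ring n\<^esub> v) = P a u \<oplus>\<^bsub>motivic_ring n\<^esub> P a v"
    and P_0: "u \<in> carrier (motivic_ring n) \<Longrightarrow> P 0 u = u"
    and Q_tau: "Q (tau n) = \<zero>\<^bsub>motivic_ring n\<^esub>"
    and P_tau: "a \<ge> 1 \<Longrightarrow> P a (tau n) = \<zero>\<^bsub>motivic_ring n\<^esub>"
    and Q_x: "i \<in> {1..n} \<Longrightarrow> Q (gen_x n i) = gen_y n i"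
    and P_x: "\<lbrakk>i \<in> {1..n}; a \<ge> 1\<rbrakk> \<Longrightarrow> P a (gen_x n i) = \<zero>\<^bsub>motivic_ring n\<^esub>"
    and Q_y: "i \<in> {1..n} \<Longrightarrow> Q (gen_y n i) = \<zero>\<^bsub>motivic_ring n\<^esub>"
    and P_1_y: "i \<in> {1..n} \<Longrightarrow> P 1 (gen_y n i) = gen_y n i [^]\<^bsub>motivic_ring n\<^esub> (2 :: nat)"
    and P_y: "\<lbrakk>i \<in> {1..n}; a \<ge> 2\<rbrakk> \<Longrightarrow> P a (gen_y n i) = \<zero>\<^bsub>motivic_ring n\<^esub>"
    and Q_mult: "\<lbrakk>u \<in> carrier (motivic_ring n); v \<in> carrier (motivic_ring n)\<rbrakk> \<Longrightarrow>
        Q (u \<otimes>\<^bsub>motivic_ring n\<^esub> v) =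
          (Q u \<otimes>\<^bsub>motivic_ring n\<^esub> v) \<oplus>\<^bsub>motivic_ring n\<^esub> (u \<otimes>\<^bsub>motivic_ring n\<^esub> Q v)"
    and P_mult: "\<lbrakk>u \<in> carrier (motivic_ring n); v \<in> carrier (motivic_ring n)\<rbrakk> \<Longrightarrow>
        P a (u \<otimes>\<^bsub>motivic_ring n\<^esub> v) =
          (\<Oplus>\<^bsub>motivic_ring n\<^esub> b \<in> {..a}. P (a - b) u \<otimes>\<^bsub>motivic_ring n\<^esub> P b v)
          \<oplus>\<^bsub>motivic_ring n\<^esub>
          (tau n \<otimes>\<^bsub>motivic_ring n\<^esub>
            (\<Oplus>\<^bsub>motivic_ring n\<^esub> b \<in> {..<a}. Q (P (a - 1 - b) u) \<otimes>\<^bsub>motivic_ring n\<^esub> Q (P b v)))"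

text \<open>
  The axioms have a solution (\<open>motivic_operations_Q0_wp\<close>), which is unique on the carrier of $M_n$
  (\<open>motivic_operations_unique\<close>), so the choice below is immaterial.
\<close>

definition Q0 :: "nat \<Rightarrow> mpoly set \<Rightarrow> mpoly set" where
  "Q0 n = fst (SOME QP. motivic_operations n (fst QP) (snd QP))"

definition wp :: "nat \<Rightarrow> nat \<Rightarrow> mpoly set \<Rightarrow> mpoly set" where
  "wp n = snd (SOME QP. motivic_operations n (fst QP) (snd QP))"

text \<open>
  \<open>steenrod n p q f\<close>: the map \<open>f\<close> is the action on $M_n$ of some element of $\mathcal{A}^{p,q}$.
  As $\mathcal{A}^{*,*}$ is generated by the homogeneous elements $\tau$, $Q_0$, $\wp^a$, its
  component of degree $(p,q)$ is spanned by the products of these of total degree $(p,q)$. All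
  generators have nonnegative degrees, so natural numbers suffice.
\<close>

inductive steenrod :: "nat \<Rightarrow> nat \<Rightarrow> nat \<Rightarrow> (mpoly set \<Rightarrow> mpoly set) \<Rightarrow> bool"
  for n :: nat where
  one: "steenrod n 0 0 (\<lambda>u. u)"
| tau: "steenrod n 0 1 (\<lambda>u. tau n \<otimes>\<^bsub>motivic_ring n\<^esub> u)"
| Q0: "steenrod n 1 0 (Q0 n)"
| wp: "a \<ge> 1 \<Longrightarrow> steenrod n (2 * a) a (wp n a)"
| zero: "steenrod n p q (\<lambda>u. \<zero>\<^bsub>motivic_ring n\<^esub>)"
| add: "steenrod n p q f \<Longrightarrow> steenrod n p q g \<Longrightarrow>
    steenrod n p q (\<lambda>u. f u \<oplus>\<^bsub>motivic_ring n\<^esub> g u)"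
| comp: "steenrod n p q f \<Longrightarrow> steenrod n p' q' g \<Longrightarrow>
    steenrod n (p + p') (q + q') (\<lambda>u. f (g u))"


section \<open>The space $QM_n^{d,*}$\<close>

abbreviation F2 :: "bit ring" where
  "F2 \<equiv> class_ring"

abbreviation F2_span :: "nat \<Rightarrow> mpoly set set \<Rightarrow> mpoly set set" where
  "F2_span n \<equiv> LinearCombinations.module.span F2 (motivic_ring n)"

definition hit :: "nat \<Rightarrow> mpoly set set" where
  "hit n = F2_span n
     {f u | f u p q. steenrod n p q f \<and> p + q > 0 \<and> u \<in> carrier (motivic_ring n)}"

definition degree_part :: "nat \<Rightarrow> nat \<Rightarrow> mpoly set set" where
  "degree_part n d = F2_span n (\<Union>w. homog n d w)"

text \<open>
  The quotient of a module by a submodule, formed of additive cosets. The fields \<open>mult\<close> and \<open>one\<close>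
  of the module record carry no meaning here.
\<close>

definition quotient_module ::
    "('a, 'b, 'm) module_scheme \<Rightarrow> 'b set \<Rightarrow> ('a, 'b set) module" where
  "quotient_module V W =
     \<lparr>carrier = a_rcosets\<^bsub>V\<^esub> W, mult = (\<lambda>A B. W), one = W, zero = W, add = set_add V,
      smult = (\<lambda>c A. \<Union>v \<in> A. W +>\<^bsub>V\<^esub> (c \<odot>\<^bsub>V\<^esub> v))\<rparr>"

definition QM :: "nat \<Rightarrow> nat \<Rightarrow> (bit, mpoly set set) module" where
  "QM n d = quotient_module (motivic_ring n \<lparr>carrier := degree_part n d\<rparr>)
     (hit n \<inter> degree_part n d)"

section \<open>Well-definedness\<close>

subsection \<open>The polynomial ring and its quotient\<close>

lemma mpoly_eq_sum: "(p :: 'a \<Rightarrow>\<^sub>0 bit) = (\<Sum>m\<in>Poly_Mapping.keys p. Poly_Mapping.single m 1)"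
proof (rule poly_mapping_eqI)
  fix k
  show "Poly_Mapping.lookup p k = Poly_Mapping.lookup (\<Sum>m\<in>Poly_Mapping.keys p. Poly_Mapping.single m 1) k"
    by (auto simp: lookup_sum lookup_single when_def in_keys_iff)
qed

lemma Var_power: "Var v ^ k = Poly_Mapping.single (Poly_Mapping.single v k) 1"
    by (induction k) (auto simp: Var_def mult_single single_add[symmetric])

lemma single_eq_prod: "Poly_Mapping.single m (1 :: bit) = (\<Prod>v\<in>Poly_Mapping.keys m. Var v ^ Poly_Mapping.lookup m v)"
proof -
  have eq: "m = (\<Sum>v\<in>Poly_Mapping.keys m. Poly_Mapping.single v (Poly_Mapping.lookup m v))"
    by (rule poly_mapping_eqI)
      (auto simp: lookup_sum lookup_single when_def in_keys_iff)
  have "finite A \<Longrightarrow> (\<Prod>v\<in>A. Poly_Mapping.single (f v) 1) = Poly_Mapping.single (\<Sum>v\<in>A. f v) (1::bit)" for A and f :: "mvar \<Rightarrow> (mvar \<Rightarrow>\<^sub>0 nat)"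
    by (induction A rule: finite_induct) (auto simp: mult_single)
  from this[OF finite_keys] show ?thesis unfolding Var_power by (metis eq)
qed

lemma polys_closed:
  "0 \<in> polys n" "1 \<in> polys n" "v \<in> mvars n \<Longrightarrow> Var v \<in> polys n"
  "Poly_Mapping.single 0 c \<in> polys n"
  "p \<in> polys n \<Longrightarrow> q \<in> polys n \<Longrightarrow> p + q \<in> polys n"
  "p \<in> polys n \<Longrightarrow> q \<in> polys n \<Longrightarrow> p * q \<in> polys n"
proof -
  show "0 \<in> polys n" "1 \<in> polys n" "v \<in> mvars n \<Longrightarrow> Var v \<in> polys n"  "Poly_Mapping.single 0 c \<in> polys n"
    by (auto simp: polys_def Var_def)
  assume pq: "p \<in> polys n" "q \<in> polys n"
  show "p + q \<in> polys n"
    using pq Poly_Mapping.keys_add[of p q] unfolding polys_def by blast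
  show "p * q \<in> polys n"
  proof -
    have "Poly_Mapping.keys m \<subseteq> mvars n" if "m \<in> Poly_Mapping.keys (p * q)" for m
    proof -
      from that keys_mult[of p q] obtain a b where "m = a + b" "a \<in> Poly_Mapping.keys p" "b \<in> Poly_Mapping.keys q"
        by blast
      thus ?thesis using pq Poly_Mapping.keys_add[of a b] unfolding polys_def by blast
    qed
    thus ?thesis by (simp add: polys_def)
  qed
qed

lemma polys_power: "p \<in> polys n \<Longrightarrow> p ^ k \<in> polys n"
  by (induction k) (auto intro: polys_closed)

lemma polys_sum: "(\<And>i. i \<in> A \<Longrightarrow> f i \<in> polys n) \<Longrightarrow> sum f A \<in> polys n"
  by (induction A rule: infinite_finite_induct) (auto intro: polys_closed)

lemma polys_prod: "(\<And>i. i \<in> A \<Longrightarrow> f i \<in> polys n) \<Longrightarrow> prod f A \<in> polys n"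
  by (induction A rule: infinite_finite_induct) (auto intro: polys_closed)

lemma polys_induct [consumes 1, case_names zero one var add mult]:
  assumes "p \<in> polys n"
    and S0: "S 0" and S1: "S 1" and Sv: "\<And>v. v \<in> mvars n \<Longrightarrow> S (Var v)"
    and Sa: "\<And>p q. p \<in> polys n \<Longrightarrow> q \<in> polys n \<Longrightarrow> S p \<Longrightarrow> S q \<Longrightarrow> S (p + q)"
    and Sm: "\<And>p q. p \<in> polys n \<Longrightarrow> q \<in> polys n \<Longrightarrow> S p \<Longrightarrow> S q \<Longrightarrow> S (p * q)"
  shows "S p"
proof -
  let ?T = "\<lambda>p. p \<in> polys n \<and> S p"
  have pow: "?T p \<Longrightarrow> ?T (p ^ k)" for p k
    by (induction k) (auto intro: polys_closed S1 Sm)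
  have sum: "(\<And>i. i \<in> A \<Longrightarrow> ?T (f i)) \<Longrightarrow> ?T (sum f A)" for A and f :: "(mvar \<Rightarrow>\<^sub>0 nat) \<Rightarrow> mpoly"
    by (induction A rule: infinite_finite_induct) (auto intro: polys_closed S0 Sa)
  have prod: "(\<And>i. i \<in> A \<Longrightarrow> ?T (f i)) \<Longrightarrow> ?T (prod f A)" for A and f :: "mvar \<Rightarrow> mpoly"
    by (induction A rule: infinite_finite_induct) (auto intro: polys_closed S1 Sm)
  have "?T (Poly_Mapping.single m 1)" if "m \<in> Poly_Mapping.keys p" for m
    unfolding single_eq_prod
  proof (intro prod pow)
    fix v assume "v \<in> Poly_Mapping.keys m"
    with that assms(1) have "v \<in> mvars n" by (auto simp: polys_def)
    thus "?T (Var v)" using Sv polys_closed by blast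
  qed
  hence "?T (\<Sum>m\<in>Poly_Mapping.keys p. Poly_Mapping.single m 1)" by (rule sum)
  thus ?thesis using mpoly_eq_sum[of p] by simp
qed

lemma char2_poly_mapping [simp]: "(p :: 'a \<Rightarrow>\<^sub>0 bit) + p = 0"
  by (rule poly_mapping_eqI) (simp add: lookup_add del: add_bit_eq_xor)

lemma uminus_mpoly [simp]: "- (p :: mpoly) = p"
  using char2_poly_mapping[of p] by (metis add_eq_0_iff)

lemma poly_ring_simps [simp]:
  "carrier (poly_ring n) = polys n" "mult (poly_ring n) = (*)" "add (poly_ring n) = (+)"
  "one (poly_ring n) = 1" "zero (poly_ring n) = 0"
  by (simp_all add: poly_ring_def)

lemma poly_ring_cring: "cring (poly_ring n)"
proof (rule cringI)
  show "abelian_group (poly_ring n)"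
  proof (rule abelian_groupI)
    fix p assume "p \<in> carrier (poly_ring n)"
    thus "\<exists>q\<in>carrier (poly_ring n). q \<oplus>\<^bsub>poly_ring n\<^esub> p = \<zero>\<^bsub>poly_ring n\<^esub>"
      by (intro bexI[of _ p]) auto
  qed (auto simp: polys_closed algebra_simps)
  show "comm_monoid (poly_ring n)"
    by (rule comm_monoidI) (auto simp: polys_closed algebra_simps)
qed (auto simp: algebra_simps)

lemma rel_gens_polys: "{Var (VX i) ^ 2 + Var VTau * Var (VY i) | i. i \<in> {1..n}} \<subseteq> polys n"
  by (auto intro!: polys_closed polys_power simp: mvars_def)

lemma rel_ideal: "ideal (rel_ideal n) (poly_ring n)"
  unfolding rel_ideal_def
  by (intro ring.genideal_ideal cring.axioms(1) poly_ring_cring) (use rel_gens_polys in auto)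

abbreviation quot :: "nat \<Rightarrow> mpoly set ring" where "quot n \<equiv> poly_ring n Quot rel_ideal n"

lemma quot_cring: "cring (quot n)"
  by (intro ideal.quotient_is_cring rel_ideal poly_ring_cring)

lemma motivic_ring_simps:
  "carrier (motivic_ring n) = carrier (quot n)" "mult (motivic_ring n) = mult (quot n)"
  "add (motivic_ring n) = add (quot n)" "one (motivic_ring n) = one (quot n)"
  "zero (motivic_ring n) = zero (quot n)"
  "smult (motivic_ring n) c u = cls n (Poly_Mapping.single 0 c) \<otimes>\<^bsub>motivic_ring n\<^esub> u"
  by (simp_all add: motivic_ring_def ring.defs module.defs)

lemma motivic_ring_cring: "cring (motivic_ring n)"
proof (rule cringI)
  interpret Qu: cring "quot n" by (rule quot_cring)
  show "abelian_group (motivic_ring n)"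
  proof (rule abelian_groupI)
    fix u assume "u \<in> carrier (motivic_ring n)"
    thus "\<exists>v\<in>carrier (motivic_ring n). v \<oplus>\<^bsub>motivic_ring n\<^esub> u = \<zero>\<^bsub>motivic_ring n\<^esub>"
      by (intro bexI[of _ "\<ominus>\<^bsub>quot n\<^esub> u"]) (auto simp: motivic_ring_simps Qu.l_neg)
  qed (auto simp: motivic_ring_simps Qu.a_ac)
  show "comm_monoid (motivic_ring n)"
    by (rule comm_monoidI) (auto simp: motivic_ring_simps Qu.m_ac)
qed (auto simp: motivic_ring_simps cring.axioms[OF quot_cring] ring.ring_simprules[OF cring.axioms(1)[OF quot_cring]])

lemma cls_hom: "cls n \<in> Ring.ring_hom (poly_ring n) (motivic_ring n)"
  using ideal.rcos_ring_hom[OF rel_ideal, of n]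
  by (auto simp: Ring.ring_hom_def motivic_ring_simps cls_def[abs_def])

lemma cls_simps:
  "p \<in> polys n \<Longrightarrow> cls n p \<in> carrier (motivic_ring n)"
  "p \<in> polys n \<Longrightarrow> q \<in> polys n \<Longrightarrow> cls n (p + q) = cls n p \<oplus>\<^bsub>motivic_ring n\<^esub> cls n q"
  "p \<in> polys n \<Longrightarrow> q \<in> polys n \<Longrightarrow> cls n (p * q) = cls n p \<otimes>\<^bsub>motivic_ring n\<^esub> cls n q"
  "cls n 1 = \<one>\<^bsub>motivic_ring n\<^esub>"
  "cls n 0 = \<zero>\<^bsub>motivic_ring n\<^esub>"
  using cls_hom[of n] Ring.ring_hom_zero[OF cls_hom cring.axioms(1)[OF poly_ring_cring] cring.axioms(1)[OF motivic_ring_cring]]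
  by (auto simp: Ring.ring_hom_def)

lemma carrier_motivic_ring: "carrier (motivic_ring n) = cls n ` polys n"
  by (auto simp: motivic_ring_simps FactRing_def A_RCOSETS_def' cls_def)

lemma cls_eq_iff:
  assumes "p \<in> polys n" "q \<in> polys n"
  shows "cls n p = cls n q \<longleftrightarrow> p + q \<in> rel_ideal n"
proof -
  interpret P: cring "poly_ring n" by (rule poly_ring_cring)
  have "\<ominus>\<^bsub>poly_ring n\<^esub> q = q"
    using assms by (intro P.minus_equality) (auto)
  hence "p \<ominus>\<^bsub>poly_ring n\<^esub> q = p + q" by (simp add: a_minus_def)
  thus ?thesis
    using P.quotient_eq_iff_same_a_r_cos[OF rel_ideal, of p q] assms by (simp add: cls_def)
qed

lemma motivic_ring_algebra: "algebra F2 (motivic_ring n)"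
proof -
  interpret R: cring "motivic_ring n" by (rule motivic_ring_cring)
  have cl: "cls n (Poly_Mapping.single 0 c) \<in> carrier (motivic_ring n)" for c
    by (intro cls_simps polys_closed)
  have ad: "cls n (Poly_Mapping.single 0 (a + b)) = cls n (Poly_Mapping.single 0 a) \<oplus>\<^bsub>motivic_ring n\<^esub> cls n (Poly_Mapping.single 0 b)" for a b
    by (simp add: single_add polys_closed flip: cls_simps(2) del: add_bit_eq_xor)
  have mu: "cls n (Poly_Mapping.single 0 (a * b)) = cls n (Poly_Mapping.single 0 a) \<otimes>\<^bsub>motivic_ring n\<^esub> cls n (Poly_Mapping.single 0 b)" for a b
    by (simp add: mult_single polys_closed flip: cls_simps(3) del: mult_bit_eq_and)
  show ?thesis
    by (rule algebraI)
      (simp_all add: motivic_ring_simps(6) cl ad mu R.is_cring class_cring.is_cring R.l_distr R.r_distr R.m_assoc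
        cls_simps del: add_bit_eq_xor mult_bit_eq_and)
qed
subsection \<open>Existence and uniqueness of the operations\<close>

lemma mpoly_eq_induct [case_names zero one var add mult]:
  assumes "S 0" "S 1" "\<And>v. S (Var v)" "\<And>p q. S p \<Longrightarrow> S q \<Longrightarrow> S (p + q)"
    "\<And>p q. S p \<Longrightarrow> S q \<Longrightarrow> S (p * q)"
  shows "S (p :: mpoly)"
proof -
  have pow: "S p \<Longrightarrow> S (p ^ k)" for p k
    by (induction k) (auto intro: assms)
  have sum: "(\<And>i. i \<in> A \<Longrightarrow> S (f i)) \<Longrightarrow> S (sum f A)" for A and f :: "(mvar \<Rightarrow>\<^sub>0 nat) \<Rightarrow> mpoly"
    by (induction A rule: infinite_finite_induct) (auto intro: assms)
  have prod: "(\<And>i. i \<in> A \<Longrightarrow> S (f i)) \<Longrightarrow> S (prod f A)" for A and f :: "mvar \<Rightarrow> mpoly"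
    by (induction A rule: infinite_finite_induct) (auto intro: assms)
  show ?thesis
    by (subst mpoly_eq_sum, intro sum, subst single_eq_prod, intro prod pow assms)
qed

text \<open>
  The total operation $R = \sum_a t^a \wp^a + u \sum_a t^a Q_0 \wp^a$ with $u^2 = \tau t$ turns
  the Cartan formulas into multiplicativity. It is constructed on the polynomial ring as the ring
  homomorphism with $R(\tau) = \tau$, $R(x_i) = x_i + u y_i$ and $R(y_i) = y_i + t y_i^2$;
  \<open>Total f g\<close> stands for $f + u g$.
\<close>

datatype total = Total (pow_part: "mpoly poly") (q_part: "mpoly poly")

instantiation total :: comm_ring_1
begin
definition "0 = Total 0 0"
definition "1 = Total 1 0"
definition "a + b = Total (pow_part a + pow_part b) (q_part a + q_part b)"
definition "a - b = Total (pow_part a - pow_part b) (q_part a - q_part b)"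
definition "- a = Total (- pow_part a) (- q_part a)"
definition "a * b = Total
  (pow_part a * pow_part b + [:0, Var VTau:] * (q_part a * q_part b))
  (q_part a * pow_part b + pow_part a * q_part b)"
instance
  by standard (simp_all add: zero_total_def one_total_def plus_total_def minus_total_def
    uminus_total_def times_total_def algebra_simps del: mult_pCons_left mult_pCons_right)
end

fun gen_total :: "mvar \<Rightarrow> total" where
  "gen_total VTau = Total [:Var VTau:] 0"
| "gen_total (VX i) = Total [:Var (VX i):] [:Var (VY i):]"
| "gen_total (VY i) = Total [:Var (VY i), Var (VY i) ^ 2:] 0"

definition mono_total :: "(mvar \<Rightarrow>\<^sub>0 nat) \<Rightarrow> total" where
  "mono_total m = (\<Prod>v \<in> Poly_Mapping.keys m. gen_total v ^ Poly_Mapping.lookup m v)"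

definition total_op :: "mpoly \<Rightarrow> total" where
  "total_op p = (\<Sum>m \<in> Poly_Mapping.keys p. if Poly_Mapping.lookup p m = 0 then 0 else mono_total m)"

lemma total_char2: "(a :: total) + a = 0"
proof -
  have "(f :: mpoly poly) + f = 0" for f
    by (rule poly_eqI) (simp only: coeff_add char2_poly_mapping coeff_0)
  thus ?thesis by (simp only: zero_total_def plus_total_def)
qed

lemma mono_total_add: "mono_total (m + m') = mono_total m * mono_total m'"
proof -
  let ?A = "Poly_Mapping.keys m \<union> Poly_Mapping.keys m'"
  have *: "mono_total k = (\<Prod>v \<in> ?A. gen_total v ^ Poly_Mapping.lookup k v)"
    if "Poly_Mapping.keys k \<subseteq> ?A" for k
    unfolding mono_total_def using that
    by (intro prod.mono_neutral_left) (auto simp: in_keys_iff)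
  show ?thesis
    using Poly_Mapping.keys_add[of m m']
    by (simp add: * lookup_add power_add prod.distrib)
qed

lemma total_add: "total_op (p + q) = total_op p + total_op q"
  unfolding total_op_def
proof (rule setsum_keys_plus_distrib)
  fix k
  show "(if Poly_Mapping.lookup p k + Poly_Mapping.lookup q k = 0 then 0 else mono_total k) =
    (if Poly_Mapping.lookup p k = 0 then 0 else mono_total k) + (if Poly_Mapping.lookup q k = 0 then 0 else mono_total k)"
    by (cases "Poly_Mapping.lookup p k"; cases "Poly_Mapping.lookup q k") (auto simp: total_char2)
qed auto

lemma total_single: "total_op (Poly_Mapping.single m 1) = mono_total m"
  by (simp add: total_op_def)

lemma total_0: "total_op 0 = 0" by (simp add: total_op_def)

lemma total_1: "total_op 1 = 1"
  using total_single[of 0] by (simp add: mono_total_def)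

lemma total_sum: "total_op (sum f A) = (\<Sum>i\<in>A. total_op (f i))"
  by (induction A rule: infinite_finite_induct) (auto simp: total_0 total_add)

lemma total_mult: "total_op (p * q) = total_op p * total_op q"
proof -
  let ?s = "\<lambda>m. Poly_Mapping.single m (1 :: bit)"
  have eq: "total_op p = (\<Sum>m\<in>Poly_Mapping.keys p. mono_total m)" for p
    by (subst mpoly_eq_sum) (simp add: total_sum total_single)
  have "p * q = (\<Sum>m\<in>Poly_Mapping.keys p. \<Sum>m'\<in>Poly_Mapping.keys q. ?s (m + m'))"
    by (subst (1) mpoly_eq_sum, subst (2) mpoly_eq_sum) (simp add: sum_product mult_single)
  hence "total_op (p * q) = (\<Sum>m\<in>Poly_Mapping.keys p. \<Sum>m'\<in>Poly_Mapping.keys q. total_op (?s (m + m')))"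
    by (simp only: total_sum)
  thus ?thesis
    by (simp add: total_single mono_total_add sum_product eq)
qed

lemma total_Var: "total_op (Var v) = gen_total v"
  by (simp add: Var_def total_single mono_total_def)

definition pow_op :: "nat \<Rightarrow> mpoly \<Rightarrow> mpoly" where
  "pow_op a p = coeff (pow_part (total_op p)) a"

definition qpow_op :: "nat \<Rightarrow> mpoly \<Rightarrow> mpoly" where
  "qpow_op a p = coeff (q_part (total_op p)) a"

lemma op_add: "pow_op a (p + q) = pow_op a p + pow_op a q"
  "qpow_op a (p + q) = qpow_op a p + qpow_op a q"
  by (simp_all add: pow_op_def qpow_op_def total_add plus_total_def)

lemma op_0 [simp]: "pow_op a 0 = 0" "qpow_op a 0 = 0"
  by (simp_all add: pow_op_def qpow_op_def total_0 zero_total_def)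

lemma op_1: "pow_op a 1 = (if a = 0 then 1 else 0)" "qpow_op a 1 = 0"
  by (simp_all add: pow_op_def qpow_op_def total_1 one_total_def coeff_1)

lemma op_sum: "pow_op a (sum f A) = (\<Sum>i\<in>A. pow_op a (f i))"
  "qpow_op a (sum f A) = (\<Sum>i\<in>A. qpow_op a (f i))"
  by (induction A rule: infinite_finite_induct) (auto simp: op_add)

lemma coeff_shift_mult: "coeff ([:0, c:] * f) a = (if a = 0 then 0 else c * coeff f (a - 1))" for c :: mpoly
  by (cases a) auto

lemma pow_op_mult: "pow_op a (p * q) =
    (\<Sum>b\<le>a. pow_op (a - b) p * pow_op b q)
    + Var VTau * (\<Sum>b<a. qpow_op (a - 1 - b) p * qpow_op b q)"
proof -
  have sw: "(\<Sum>b\<le>a. f b (a - b)) = (\<Sum>b\<le>a. f (a - b) b)" for a and f :: "nat \<Rightarrow> nat \<Rightarrow> mpoly"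
    by (rule sum.reindex_bij_witness[of _ "\<lambda>i. a - i" "\<lambda>i. a - i"]) auto
  show ?thesis
  proof (cases a)
    case 0
    thus ?thesis by (simp add: pow_op_def qpow_op_def total_mult times_total_def coeff_shift_mult coeff_mult_0)
  next
    case (Suc c)
    have "pow_op a (p * q) = coeff (pow_part (total_op p) * pow_part (total_op q)) a
        + Var VTau * coeff (q_part (total_op p) * q_part (total_op q)) c"
      using Suc by (simp add: pow_op_def total_mult times_total_def coeff_shift_mult del: mult_pCons_left)
    moreover have "{..<a} = {..c}" using Suc by auto
    ultimately show ?thesis using Suc
      by (simp add: pow_op_def qpow_op_def coeff_mult
          sw[of "\<lambda>i j. coeff (pow_part (total_op p)) i * coeff (pow_part (total_op q)) j"]
          sw[of "\<lambda>i j. coeff (q_part (total_op p)) i * coeff (q_part (total_op q)) j"] del: sum.atMost_Suc)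
  qed
qed

lemma qpow_op_mult: "qpow_op a (p * q) =
    (\<Sum>b\<le>a. qpow_op b p * pow_op (a - b) q) + (\<Sum>b\<le>a. pow_op b p * qpow_op (a - b) q)"
  by (simp add: pow_op_def qpow_op_def total_mult times_total_def coeff_mult)

lemma op_Var:
  "pow_op a (Var VTau) = (if a = 0 then Var VTau else 0)" "qpow_op a (Var VTau) = 0"
  "pow_op a (Var (VX i)) = (if a = 0 then Var (VX i) else 0)"
  "qpow_op a (Var (VX i)) = (if a = 0 then Var (VY i) else 0)"
  "pow_op a (Var (VY i)) = (if a = 0 then Var (VY i) else if a = 1 then Var (VY i) ^ 2 else 0)"
  "qpow_op a (Var (VY i)) = 0"
  by (auto simp: pow_op_def qpow_op_def total_Var coeff_pCons split: nat.splits)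

lemma pow_op_0: "pow_op 0 p = p"
proof (induction p rule: mpoly_eq_induct)
  case (var v)
  show ?case by (cases v) (auto simp: op_Var)
qed (auto simp: op_add op_1 pow_op_mult)

lemma Q_op_mult: "qpow_op 0 (p * q) = qpow_op 0 p * q + p * qpow_op 0 q"
  by (simp add: qpow_op_mult pow_op_0)

lemma Q_op_square: "qpow_op 0 (qpow_op 0 p) = 0"
proof (induction p rule: mpoly_eq_induct)
  case (var v)
  show ?case by (cases v) (auto simp: op_Var)
next
  case (mult p q)
  have "qpow_op 0 (qpow_op 0 (p * q)) = qpow_op 0 p * qpow_op 0 q + qpow_op 0 p * qpow_op 0 q"
    by (simp add: Q_op_mult op_add mult)
  thus ?case by simp
qed (auto simp: op_add op_1)

lemma Q_pow_op: "qpow_op 0 (pow_op a p) = qpow_op a p"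
proof (induction p arbitrary: a rule: mpoly_eq_induct)
  case (var v)
  show ?case by (cases v) (auto simp: op_Var Q_op_mult power2_eq_square)
next
  case (mult p q)
  have QQ: "qpow_op 0 (qpow_op b r) = 0" if "\<And>a. qpow_op 0 (pow_op a r) = qpow_op a r" for b r
    using Q_op_square[of "pow_op b r"] that by simp
  have sw: "(\<Sum>b\<le>a. f b (a - b)) = (\<Sum>b\<le>a. f (a - b) b)" for a and f :: "nat \<Rightarrow> nat \<Rightarrow> mpoly"
    by (rule sum.reindex_bij_witness[of _ "\<lambda>i. a - i" "\<lambda>i. a - i"]) auto
  show ?case
    by (simp add: pow_op_mult op_add op_sum Q_op_mult op_Var mult QQ qpow_op_mult pow_op_0 sum.distrib
      sw[of "\<lambda>i j. qpow_op i p * pow_op j q"] sw[of "\<lambda>i j. pow_op i p * qpow_op j q"])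
qed (auto simp: op_add op_1)

lemma op_closed: "p \<in> polys n \<Longrightarrow> pow_op a p \<in> polys n \<and> qpow_op a p \<in> polys n"
proof (induction p arbitrary: a rule: polys_induct)
  case (var v)
  thus ?case by (cases v) (auto simp: op_Var mvars_def intro!: polys_closed polys_power)
next
  case (mult p q)
  thus ?case unfolding pow_op_mult qpow_op_mult
    by (auto simp: mvars_def intro!: polys_closed polys_sum)
qed (auto simp: op_add op_1 intro: polys_closed)

lemma op_rel: "p \<in> rel_ideal n \<Longrightarrow> pow_op a p \<in> rel_ideal n \<and> qpow_op a p \<in> rel_ideal n"
proof -
  interpret P: cring "poly_ring n" by (rule poly_ring_cring)
  interpret I: ideal "rel_ideal n" "poly_ring n" by (rule rel_ideal)
  have sum: "(\<And>i. i \<in> A \<Longrightarrow> f i \<in> rel_ideal n) \<Longrightarrow> sum f A \<in> rel_ideal n" for f and A :: "nat set"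
    using I.zero_closed I.a_closed by (induction A rule: infinite_finite_induct) auto
  let ?J = "{p \<in> rel_ideal n. \<forall>a. pow_op a p \<in> rel_ideal n \<and> qpow_op a p \<in> rel_ideal n}"
  have sub: "p \<in> rel_ideal n \<Longrightarrow> p \<in> polys n" for p using I.a_subset by auto
  have mulI: "p \<in> polys n \<Longrightarrow> q \<in> rel_ideal n \<Longrightarrow> p * q \<in> rel_ideal n"
    "p \<in> rel_ideal n \<Longrightarrow> q \<in> polys n \<Longrightarrow> p * q \<in> rel_ideal n" for p q
    using I.I_l_closed I.I_r_closed by auto
  have addI: "p \<in> rel_ideal n \<Longrightarrow> q \<in> rel_ideal n \<Longrightarrow> p + q \<in> rel_ideal n" for p q
    using I.a_closed by auto
  have VTau: "Var VTau \<in> polys n" by (rule polys_closed) (simp add: mvars_def)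
  have mulJ: "p * q \<in> ?J" if "p \<in> ?J" "q \<in> polys n" for p q
    using that op_closed[OF that(2)]
    by (auto simp: pow_op_mult qpow_op_mult intro!: addI mulI(1)[OF VTau] mulI(2) sum)
  have "ideal ?J (poly_ring n)"
  proof (rule idealI)
    show "ring (poly_ring n)" ..
    show "subgroup ?J (add_monoid (poly_ring n))"
    proof (rule P.add.subgroupI)
      show "?J \<noteq> {}" using I.zero_closed by auto
      show "\<ominus>\<^bsub>poly_ring n\<^esub> p \<in> ?J" if "p \<in> ?J" for p
      proof -
        have "\<ominus>\<^bsub>poly_ring n\<^esub> p = p" using that sub by (intro P.minus_equality) auto
        thus ?thesis using that by simp
      qed
    qed (auto simp: op_add sub intro: addI)
  next
    fix p q assume pq: "p \<in> ?J" "q \<in> carrier (poly_ring n)"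
    thus "p \<otimes>\<^bsub>poly_ring n\<^esub> q \<in> ?J" using mulJ by simp
    thus "q \<otimes>\<^bsub>poly_ring n\<^esub> p \<in> ?J" by (simp add: mult.commute)
  qed
  moreover have "{Var (VX i) ^ 2 + Var VTau * Var (VY i) | i. i \<in> {1..n}} \<subseteq> ?J"
  proof safe
    fix i assume i: "i \<in> {1..n}"
    let ?g = "Var (VX i) ^ 2 + Var VTau * Var (VY i)"
    show g: "?g \<in> rel_ideal n"
      unfolding rel_ideal_def using i P.genideal_self[of "{Var (VX i) ^ 2 + Var VTau * Var (VY i) | i. i \<in> {1..n}}"] rel_gens_polys
      by auto
    have two: "2 * p = 0" for p :: mpoly by (simp only: mult_2 char2_poly_mapping)
    have c2: "p + (p + q) = q" "p + (q + p) = q" for p q :: mpoly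
      by (simp_all add: add.left_commute[of p q p] add.assoc[symmetric] two)
    have t: "total_op ?g = Total [:?g:] 0"
      using two by (simp add: total_add total_mult total_Var power2_eq_square plus_total_def times_total_def c2)
    show "pow_op a ?g \<in> rel_ideal n" "qpow_op a ?g \<in> rel_ideal n" for a
      using g I.zero_closed by (auto simp: pow_op_def qpow_op_def t coeff_pCons split: nat.splits)
  qed
  ultimately have "rel_ideal n \<subseteq> ?J"
    unfolding rel_ideal_def by (rule P.genideal_minimal)
  thus "p \<in> rel_ideal n \<Longrightarrow> pow_op a p \<in> rel_ideal n \<and> qpow_op a p \<in> rel_ideal n" by blast
qed

definition lift_op :: "nat \<Rightarrow> (mpoly \<Rightarrow> mpoly) \<Rightarrow> mpoly set \<Rightarrow> mpoly set" where
  "lift_op n f u = cls n (f (SOME p. p \<in> polys n \<and> cls n p = u))"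

lemma lift_op:
  assumes "\<And>p q. f (p + q) = f p + f q" "\<And>p. p \<in> polys n \<Longrightarrow> f p \<in> polys n"
    "\<And>p. p \<in> rel_ideal n \<Longrightarrow> f p \<in> rel_ideal n" "p \<in> polys n"
  shows "lift_op n f (cls n p) = cls n (f p)"
proof -
  define q where "q = (SOME q. q \<in> polys n \<and> cls n q = cls n p)"
  have "q \<in> polys n \<and> cls n q = cls n p"
    unfolding q_def by (rule someI[of _ p]) (simp add: assms)
  hence "f q + f p \<in> rel_ideal n" "q \<in> polys n" using assms cls_eq_iff[of q n p] by metis+
  hence "cls n (f q) = cls n (f p)" using assms by (simp add: cls_eq_iff)
  thus ?thesis by (simp add: lift_op_def q_def)
qed

lemma lift_ops:
  assumes "p \<in> polys n"
  shows "lift_op n (qpow_op 0) (cls n p) = cls n (qpow_op 0 p)" "lift_op n (pow_op a) (cls n p) = cls n (pow_op a p)"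
  using assms by (simp_all add: lift_op op_add op_closed op_rel)

lemma cls_finsum:
  fixes A :: "nat set"
  shows "finite A \<Longrightarrow> (\<And>i. i \<in> A \<Longrightarrow> f i \<in> polys n) \<Longrightarrow> (\<Oplus>\<^bsub>motivic_ring n\<^esub> i \<in> A. cls n (f i)) = cls n (sum f A)"
proof (induction A rule: finite_induct)
  case empty
  interpret R: cring "motivic_ring n" by (rule motivic_ring_cring)
  show ?case by (simp add: cls_simps)
next
  case (insert i A)
  interpret R: cring "motivic_ring n" by (rule motivic_ring_cring)
  show ?case using insert
    by (subst R.finsum_insert) (auto simp: cls_simps polys_sum)
qed

lemma motivic_operations_exist: "motivic_operations n (lift_op n (qpow_op 0)) (\<lambda>a. lift_op n (pow_op a))"
proof -
  interpret R: cring "motivic_ring n" by (rule motivic_ring_cring)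
  have V: "Var VTau \<in> polys n" "i \<in> {1..n} \<Longrightarrow> Var (VX i) \<in> polys n" "i \<in> {1..n} \<Longrightarrow> Var (VY i) \<in> polys n" for i
    by (auto intro!: polys_closed simp: mvars_def)
  note oc = op_closed[THEN conjunct1] op_closed[THEN conjunct2]
  show ?thesis
  proof (unfold_locales, goal_cases)
    case (14 u v a)
    then obtain p q where pq: "p \<in> polys n" "u = cls n p" "q \<in> polys n" "v = cls n q"
      by (auto simp: carrier_motivic_ring)
    have "(\<Oplus>\<^bsub>motivic_ring n\<^esub> b \<in> {..a}. lift_op n (pow_op (a - b)) u \<otimes>\<^bsub>motivic_ring n\<^esub> lift_op n (pow_op b) v)
      = (\<Oplus>\<^bsub>motivic_ring n\<^esub> b \<in> {..a}. cls n (pow_op (a - b) p * pow_op b q))"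
      by (intro R.finsum_cong') (auto simp: pq lift_ops oc cls_simps polys_closed)
    also have "\<dots> = cls n (\<Sum>b\<le>a. pow_op (a - b) p * pow_op b q)"
      by (rule cls_finsum) (auto simp: pq oc polys_closed)
    finally have 1: "(\<Oplus>\<^bsub>motivic_ring n\<^esub> b \<in> {..a}. lift_op n (pow_op (a - b)) u \<otimes>\<^bsub>motivic_ring n\<^esub> lift_op n (pow_op b) v) = \<dots>" .
    have "(\<Oplus>\<^bsub>motivic_ring n\<^esub> b \<in> {..<a}. lift_op n (qpow_op 0) (lift_op n (pow_op (a - 1 - b)) u) \<otimes>\<^bsub>motivic_ring n\<^esub> lift_op n (qpow_op 0) (lift_op n (pow_op b) v))
      = (\<Oplus>\<^bsub>motivic_ring n\<^esub> b \<in> {..<a}. cls n (qpow_op (a - 1 - b) p * qpow_op b q))"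
      by (intro R.finsum_cong') (auto simp: pq lift_ops oc cls_simps polys_closed Q_pow_op)
    also have "\<dots> = cls n (\<Sum>b<a. qpow_op (a - 1 - b) p * qpow_op b q)"
      by (rule cls_finsum) (auto simp: pq oc polys_closed)
    finally have 2: "(\<Oplus>\<^bsub>motivic_ring n\<^esub> b \<in> {..<a}. lift_op n (qpow_op 0) (lift_op n (pow_op (a - 1 - b)) u) \<otimes>\<^bsub>motivic_ring n\<^esub> lift_op n (qpow_op 0) (lift_op n (pow_op b) v)) = \<dots>" .
    have 3: "lift_op n (pow_op a) (u \<otimes>\<^bsub>motivic_ring n\<^esub> v) = cls n (pow_op a (p * q))"
      by (simp add: pq cls_simps(3)[symmetric] lift_ops polys_closed)
    have 4: "(\<Sum>b\<le>a. pow_op (a - b) p * pow_op b q) \<in> polys n" "(\<Sum>b<a. qpow_op (a - 1 - b) p * qpow_op b q) \<in> polys n"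
      by (intro polys_sum polys_closed oc pq)+
    show ?case unfolding 1 2 3 pow_op_mult
      by (simp only: 4 V cls_simps polys_closed)
  next
    case 1 then show ?case by (auto simp: carrier_motivic_ring lift_ops oc)
  next
    case 2 then show ?case by (auto simp: carrier_motivic_ring lift_ops oc)
  next
    case 3 then show ?case by (auto simp: carrier_motivic_ring lift_ops oc polys_closed op_add simp flip: cls_simps(2))
  next
    case 4 then show ?case by (auto simp: carrier_motivic_ring lift_ops oc polys_closed op_add simp flip: cls_simps(2))
  next
    case 5 then show ?case by (auto simp: carrier_motivic_ring lift_ops pow_op_0)
  next
    case 13 then show ?case
      by (auto simp: carrier_motivic_ring lift_ops oc polys_closed Q_op_mult simp flip: cls_simps(2,3))
  next
    case 11 then show ?case
      by (simp add: lift_ops V op_Var power2_eq_square R.nat_pow_Suc numeral_2_eq_2 cls_simps polys_closed del: One_nat_def)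
  qed (simp_all add: lift_ops V op_Var cls_simps(5))
qed

lemma motivic_operations_Q0_wp: "motivic_operations n (Q0 n) (wp n)"
  using someI[of "\<lambda>QP. motivic_operations n (fst QP) (snd QP)", of "(_, _)"] motivic_operations_exist[of n]
  by (auto simp: Q0_def wp_def)

lemma motivic_operations_unique:
  assumes "motivic_operations n Q P" "motivic_operations n Q' P'" "u \<in> carrier (motivic_ring n)"
  shows "Q u = Q' u" "P a u = P' a u"
proof -
  interpret R: cring "motivic_ring n" by (rule motivic_ring_cring)
  have cases_var: "S (cls n (Var v))" if "v \<in> mvars n" "S (tau n)"
    "\<And>i. i \<in> {1..n} \<Longrightarrow> S (gen_x n i)" "\<And>i. i \<in> {1..n} \<Longrightarrow> S (gen_y n i)" for S v
    using that by (cases v) (auto simp: mvars_def)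
  have self_add: "z = \<zero>\<^bsub>motivic_ring n\<^esub>" if "z = z \<oplus>\<^bsub>motivic_ring n\<^esub> z" "z \<in> carrier (motivic_ring n)" for z
    using that R.add.l_cancel_one' by metis
  have op_zero: "Q \<zero>\<^bsub>motivic_ring n\<^esub> = \<zero>\<^bsub>motivic_ring n\<^esub>" "P a \<zero>\<^bsub>motivic_ring n\<^esub> = \<zero>\<^bsub>motivic_ring n\<^esub>"
    if "motivic_operations n Q P" for Q P a
  proof -
    interpret O: motivic_operations n Q P by fact
    show "Q \<zero>\<^bsub>motivic_ring n\<^esub> = \<zero>\<^bsub>motivic_ring n\<^esub>"
      using O.Q_add[OF R.zero_closed R.zero_closed] O.Q_closed by (intro self_add) auto
    show "P a \<zero>\<^bsub>motivic_ring n\<^esub> = \<zero>\<^bsub>motivic_ring n\<^esub>"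
      using O.P_add[OF R.zero_closed R.zero_closed] O.P_closed by (intro self_add) auto
  qed
  have one_Q: "Q \<one>\<^bsub>motivic_ring n\<^esub> = \<zero>\<^bsub>motivic_ring n\<^esub>" if "motivic_operations n Q P" for Q P
  proof -
    interpret O: motivic_operations n Q P by fact
    show ?thesis using O.Q_mult[OF R.one_closed R.one_closed] O.Q_closed by (intro self_add) auto
  qed
  have one_P: "P a \<one>\<^bsub>motivic_ring n\<^esub> = \<zero>\<^bsub>motivic_ring n\<^esub>" if "motivic_operations n Q P" "a \<ge> 1" for Q P a
    using that(2)
  proof (induction a rule: less_induct)
    case (less a)
    interpret O: motivic_operations n Q P by fact
    let ?R = "motivic_ring n" and ?e = "\<one>\<^bsub>motivic_ring n\<^esub>"
    have IH: "P b ?e = (if b = 0 then ?e else \<zero>\<^bsub>?R\<^esub>)" if "b < a" for b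
      using less.IH[of b] that O.P_0 by auto
    obtain c where c: "a = Suc c" using less.prems by (cases a) auto
    have cl: "P b ?e \<in> carrier ?R" "Q (P b ?e) \<in> carrier ?R" for b by (auto intro: O.P_closed O.Q_closed)
    have A: "(\<Oplus>\<^bsub>?R\<^esub> b \<in> {..<a}. Q (P (a - 1 - b) ?e) \<otimes>\<^bsub>?R\<^esub> Q (P b ?e)) = (\<Oplus>\<^bsub>?R\<^esub> b \<in> {..<a}. \<zero>\<^bsub>?R\<^esub>)"
      using IH by (intro R.finsum_cong') (auto simp: op_zero(1)[OF that(1)] one_Q[OF that(1)] cl)
    have "(\<Oplus>\<^bsub>?R\<^esub> b \<in> {..<a} - {0}. P (a - b) ?e \<otimes>\<^bsub>?R\<^esub> P b ?e) = (\<Oplus>\<^bsub>?R\<^esub> b \<in> {..<a} - {0}. \<zero>\<^bsub>?R\<^esub>)"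
      using IH by (intro R.finsum_cong') (auto simp: cl)
    hence B0: "(\<Oplus>\<^bsub>?R\<^esub> b \<in> {..<a} - {0}. P (a - b) ?e \<otimes>\<^bsub>?R\<^esub> P b ?e) = \<zero>\<^bsub>?R\<^esub>" by simp
    have "{..a} = insert 0 (insert a ({..<a} - {0}))" using c by auto
    hence B: "(\<Oplus>\<^bsub>?R\<^esub> b \<in> {..a}. P (a - b) ?e \<otimes>\<^bsub>?R\<^esub> P b ?e) = P a ?e \<oplus>\<^bsub>?R\<^esub> P a ?e"
      using c B0 by (simp add: cl Pi_def O.P_0)
    have T: "tau n \<in> carrier ?R" by (intro cls_simps polys_closed) (simp add: mvars_def)
    have "P a (?e \<otimes>\<^bsub>?R\<^esub> ?e) = P a ?e \<oplus>\<^bsub>?R\<^esub> P a ?e"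
      unfolding O.P_mult[OF R.one_closed R.one_closed] A B by (simp add: cl T)
    thus ?case by (intro self_add) (simp_all add: cl)
  qed
  interpret O: motivic_operations n Q P by fact
  interpret O': motivic_operations n Q' P' by fact
  have Q_eq: "Q (cls n p) = Q' (cls n p)" if "p \<in> polys n" for p
    using that
  proof (induction p rule: polys_induct)
    case (var v)
    show ?case by (rule cases_var[OF var]) (simp_all add: O.Q_tau O'.Q_tau O.Q_x O'.Q_x O.Q_y O'.Q_y)
  qed (simp_all add: cls_simps op_zero(1)[OF assms(1)] op_zero(1)[OF assms(2)] one_Q[OF assms(1)] one_Q[OF assms(2)] O.Q_add O'.Q_add O.Q_mult O'.Q_mult)
  hence Q_eq': "Q u = Q' u" if "u \<in> carrier (motivic_ring n)" for u
    using that by (auto simp: carrier_motivic_ring)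
  have P_eq: "P a (cls n p) = P' a (cls n p)" if "p \<in> polys n" for p a
    using that
  proof (induction p arbitrary: a rule: polys_induct)
    case (var v)
    have V: "cls n (Var v) \<in> carrier (motivic_ring n)" using var by (intro cls_simps polys_closed)
    show ?case
    proof (cases "a = 0")
      case True
      thus ?thesis using V by (simp add: O.P_0 O'.P_0)
    next
      case False
      thus ?thesis
        using O.P_tau[of a] O'.P_tau[of a] O.P_x[of _ a] O'.P_x[of _ a] O.P_1_y O'.P_1_y
          O.P_y[of _ a] O'.P_y[of _ a]
        by (intro cases_var[OF var, of "\<lambda>z. P a z = P' a z"]; cases "a = 1") auto
    qed
  next
    case one
    show ?case
      unfolding cls_simps(4)
      using one_P[OF assms(1), of a] one_P[OF assms(2), of a] O.P_0[OF R.one_closed] O'.P_0[OF R.one_closed]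
      by (cases "a = 0") auto
  next
    case (mult p q)
    note cl = cls_simps(1)[OF mult.hyps(1)] cls_simps(1)[OF mult.hyps(2)]
    show ?case
      unfolding cls_simps(3)[OF mult.hyps(1,2)] O.P_mult[OF cl] O'.P_mult[OF cl]
      by (simp add: mult.IH Q_eq' O'.P_closed cl)
  next
    case zero
    show ?case unfolding cls_simps(5) op_zero(2)[OF assms(1)] op_zero(2)[OF assms(2)] ..
  next
    case (add p q)
    note cl = cls_simps(1)[OF add.hyps(1)] cls_simps(1)[OF add.hyps(2)]
    show ?case
      unfolding cls_simps(2)[OF add.hyps(1,2)] O.P_add[OF cl] O'.P_add[OF cl] by (simp only: add.IH)
  qed
  show "Q u = Q' u" "P a u = P' a u"
    using assms(3) Q_eq P_eq by (auto simp: carrier_motivic_ring)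
qed

subsection \<open>The vector space structure on $QM_n^{d,*}$\<close>

lemma steenrod_closed:
  assumes "steenrod n p q f" "u \<in> carrier (motivic_ring n)"
  shows "f u \<in> carrier (motivic_ring n)"
proof -
  interpret R: cring "motivic_ring n" by (rule motivic_ring_cring)
  interpret O: motivic_operations n "Q0 n" "wp n" by (rule motivic_operations_Q0_wp)
  have T: "tau n \<in> carrier (motivic_ring n)" by (intro cls_simps polys_closed) (simp add: mvars_def)
  show ?thesis using assms
    by (induction arbitrary: u rule: steenrod.induct) (auto simp: T O.Q_closed O.P_closed)
qed

lemma quotient_module_vectorspace:
  assumes "vectorspace K V" "submodule K W V"
  shows "vectorspace K (quotient_module V W)"
proof -
  interpret V: vectorspace K V by fact
  interpret W: submodule K W V by fact
  let ?Q = "quotient_module V W"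
  have "subgroup W (add_monoid V)"
  proof (rule V.add.subgroupI)
    fix w assume w: "w \<in> W"
    hence "\<ominus>\<^bsub>V\<^esub> w = (\<ominus>\<^bsub>K\<^esub> \<one>\<^bsub>K\<^esub>) \<odot>\<^bsub>V\<^esub> w"
      using W.subset V.smult_minus_1[of w] by (metis subsetD)
    also have "\<dots> \<in> W" using w by (intro W.smult_closed) auto
    finally show "\<ominus>\<^bsub>V\<^esub> w \<in> W" .
  next
    show "W \<noteq> {}" using W.zero_closed by blast
  qed (use W.subset in auto)
  then interpret S: abelian_subgroup W V
    by (intro abelian_subgroupI3 additive_subgroup.intro V.abelian_group_axioms)
  have carr: "carrier ?Q = (\<lambda>v. W +>\<^bsub>V\<^esub> v) ` carrier V"
    by (auto simp: quotient_module_def A_RCOSETS_def')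
  have add: "(W +>\<^bsub>V\<^esub> u) \<oplus>\<^bsub>?Q\<^esub> (W +>\<^bsub>V\<^esub> v) = W +>\<^bsub>V\<^esub> (u \<oplus>\<^bsub>V\<^esub> v)" if "u \<in> carrier V" "v \<in> carrier V" for u v
    using that by (simp add: quotient_module_def S.a_rcos_sum)
  have zero: "\<zero>\<^bsub>?Q\<^esub> = W +>\<^bsub>V\<^esub> \<zero>\<^bsub>V\<^esub>"
    using S.a_rcos_const[OF W.zero_closed] by (simp add: quotient_module_def)
  have smult: "c \<odot>\<^bsub>?Q\<^esub> (W +>\<^bsub>V\<^esub> v) = W +>\<^bsub>V\<^esub> (c \<odot>\<^bsub>V\<^esub> v)" if "c \<in> carrier K" "v \<in> carrier V" for c v
  proof -
    have "W +>\<^bsub>V\<^esub> (c \<odot>\<^bsub>V\<^esub> (w \<oplus>\<^bsub>V\<^esub> v)) = W +>\<^bsub>V\<^esub> (c \<odot>\<^bsub>V\<^esub> v)" if w: "w \<in> W" for w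
    proof -
      have "c \<odot>\<^bsub>V\<^esub> (w \<oplus>\<^bsub>V\<^esub> v) = (c \<odot>\<^bsub>V\<^esub> w) \<oplus>\<^bsub>V\<^esub> (c \<odot>\<^bsub>V\<^esub> v)"
        using w W.subset \<open>c \<in> carrier K\<close> \<open>v \<in> carrier V\<close> by (intro V.smult_r_distr) auto
      moreover have cw: "c \<odot>\<^bsub>V\<^esub> w \<in> W" using w \<open>c \<in> carrier K\<close> by (rule W.smult_closed[rotated])
      ultimately have "W +>\<^bsub>V\<^esub> (c \<odot>\<^bsub>V\<^esub> (w \<oplus>\<^bsub>V\<^esub> v)) = (W +>\<^bsub>V\<^esub> (c \<odot>\<^bsub>V\<^esub> w)) <+>\<^bsub>V\<^esub> (W +>\<^bsub>V\<^esub> (c \<odot>\<^bsub>V\<^esub> v))"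
        using W.subset \<open>c \<in> carrier K\<close> \<open>v \<in> carrier V\<close> by (subst S.a_rcos_sum) auto
      also have "\<dots> = (W +>\<^bsub>V\<^esub> \<zero>\<^bsub>V\<^esub>) <+>\<^bsub>V\<^esub> (W +>\<^bsub>V\<^esub> (c \<odot>\<^bsub>V\<^esub> v))"
        using S.a_rcos_const[OF cw] S.a_rcos_const[OF W.zero_closed] by simp
      also have "\<dots> = W +>\<^bsub>V\<^esub> (c \<odot>\<^bsub>V\<^esub> v)"
        using \<open>c \<in> carrier K\<close> \<open>v \<in> carrier V\<close> by (subst S.a_rcos_sum) auto
      finally show ?thesis .
    qed
    moreover have "W +>\<^bsub>V\<^esub> v = (\<lambda>w. w \<oplus>\<^bsub>V\<^esub> v) ` W" by (auto simp: a_r_coset_def')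
    moreover have "W \<noteq> {}" using W.zero_closed by blast
    ultimately show ?thesis by (simp add: quotient_module_def)
  qed
  have "module K ?Q"
  proof (rule moduleI)
    show "abelian_group ?Q"
    proof (rule abelian_groupI)
      fix A assume "A \<in> carrier ?Q"
      then obtain v where "v \<in> carrier V" "A = W +>\<^bsub>V\<^esub> v" by (auto simp: carr)
      thus "\<exists>B\<in>carrier ?Q. B \<oplus>\<^bsub>?Q\<^esub> A = \<zero>\<^bsub>?Q\<^esub>"
        by (intro bexI[of _ "W +>\<^bsub>V\<^esub> (\<ominus>\<^bsub>V\<^esub> v)"]) (auto simp: add carr zero V.l_neg)
    qed (auto simp: carr add zero V.a_ac)
    show "cring K" ..
  qed (auto simp: carr add smult V.smult_l_distr V.smult_r_distr V.smult_assoc1)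
  thus ?thesis by (intro vectorspace.intro V.field_axioms)
qed

lemma QM_vectorspace: "vectorspace F2 (QM n d)"
proof -
  interpret A: algebra F2 "motivic_ring n" by (rule motivic_ring_algebra)
  have F: "field F2" by (rule class_field)
  have D: "submodule F2 (degree_part n d) (motivic_ring n)"
    unfolding degree_part_def
    by (intro A.span_is_submodule) (auto simp: homog_def cls_simps)
  have H: "submodule F2 (hit n) (motivic_ring n)"
    unfolding hit_def
    by (intro A.span_is_submodule) (auto intro: steenrod_closed)
  interpret D: submodule F2 "degree_part n d" "motivic_ring n" by (rule D)
  interpret H: submodule F2 "hit n" "motivic_ring n" by (rule H)
  have m: "module F2 (motivic_ring n\<lparr>carrier := degree_part n d\<rparr>)"
    by (rule A.submodule_is_module[OF D])
  show ?thesis unfolding QM_def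
  proof (rule quotient_module_vectorspace)
    show "vectorspace F2 (motivic_ring n\<lparr>carrier := degree_part n d\<rparr>)"
      by (intro vectorspace.intro F m)
    show "submodule F2 (hit n \<inter> degree_part n d) (motivic_ring n\<lparr>carrier := degree_part n d\<rparr>)"
      by (rule submodule.intro[OF m]) auto
  qed
qed

end

theory Submission
  imports Defs
begin

text \<open>
  For the bound on $\beta$: a sum of $s$ powers of 2 has at most $s$ binary digits 1, $\alpha$ is
  subadditive, and $d + n = (n-2) 2^{n-2} + (2^{n-2} - 1)$ has $\alpha(n-2) + n - 2 > n$ of them.

  Modulo $\tau$ the ring $M_n$ is an exterior algebra on the $x_i$ over the polynomial ring in the
  $y_i$; there $Q_0$ is the Koszul differential, and the $\wp^a$ with $a \ge 1$ kill the $x_i$ and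
  act on the $y_i$ like Steenrod squares. The functional $\theta$ dual to $\prod_i y_i^{2^k-1}$
  vanishes on all $\wp^a u$ with $a \ge 1$. Let $Q_j$ be the derivation with $x_i \mapsto y_i^{2^j}$,
  $y_i \mapsto 0$. Commuting $Q_j$ with powers $\wp^a$ only produces $Q_{j+1}$, and $\theta$
  vanishes on the image of $Q_j$ for $j \ge k$; hence $\theta \circ Q_0 \cdots Q_{k-1}$ vanishes
  on all hit elements. It takes the value 1 exactly on the monomials
  $\prod_{i \in I} x_i \prod_i y_i^{e_i}$ for which there is a bijection
  $\sigma : I \to \{0,\dots,k-1\}$ with $e_i = 2^k - 1 - 2^{\sigma(i)}$ for $i \in I$, and
  $e_i = 2^k - 1$ otherwise. These monomials are therefore not hit, and their first degree is
  $(n-1)(2^{k+1}-2) + k$.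

  With this description the vanishing is elementary: in the image of a monomial, the monomials on
  which the functional is 1 cancel in pairs under the exchange of two indices.
\<close>

section \<open>The bound on $\beta$\<close>

lemma finite_bits: "finite {i. bit (t :: nat) i}"
proof (rule finite_subset)
  show "{i. bit t i} \<subseteq> {..t}"
  proof safe
    fix i assume "bit t i"
    hence "\<not> t < 2 ^ i" by (auto simp: bit_iff_odd)
    thus "i \<le> t" using less_exp[of i] by linarith
  qed
qed simp

lemma alpha_0: "alpha 0 = 0"
  by (simp add: alpha_def)

lemma alpha_double: "alpha (2 * t) = alpha t"
proof -
  have "{i. bit (2 * t) i} = Suc ` {i. bit t i}"
  proof (rule Set.set_eqI)
    fix i show "i \<in> {i. bit (2 * t) i} \<longleftrightarrow> i \<in> Suc ` {i. bit t i}"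
      by (cases i) (auto simp: bit_0 bit_Suc)
  qed
  thus ?thesis by (simp add: alpha_def card_image)
qed

lemma alpha_Suc_double: "alpha (Suc (2 * t)) = Suc (alpha t)"
proof -
  have "{i. bit (Suc (2 * t)) i} = insert 0 (Suc ` {i. bit t i})"
  proof (rule Set.set_eqI)
    fix i show "i \<in> {i. bit (Suc (2 * t)) i} \<longleftrightarrow> i \<in> insert 0 (Suc ` {i. bit t i})"
      by (cases i) (auto simp: bit_0 bit_Suc)
  qed
  moreover have "card (insert 0 (Suc ` {i. bit t i})) = Suc (card {i. bit t i})"
    by (subst card_insert_disjoint) (auto simp: card_image finite_bits)
  ultimately show ?thesis by (simp only: alpha_def)
qed

text \<open>Adding 1 turns a trailing block of ones into zeros and the digit above it into a one.
  Halving strips that block one digit at a time.\<close>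

lemma alpha_Suc_le: "alpha (Suc t) \<le> Suc (alpha t)"
proof (induction t rule: less_induct)
  case (less t)
  show ?case
  proof (cases "even t")
    case True
    then obtain s where "t = 2 * s" by (elim evenE)
    thus ?thesis by (simp add: alpha_double alpha_Suc_double)
  next
    case False
    then obtain s where s: "t = Suc (2 * s)" by (auto elim: oddE)
    hence "alpha (Suc t) = alpha (2 * Suc s)" by simp
    thus ?thesis using less.IH[of s] s by (simp only: alpha_double alpha_Suc_double) simp
  qed
qed

text \<open>Split off the last digits \<open>p\<close> and \<open>q\<close> of the summands. If both
  are 1, the carry replaces two digits by a single increment of \<open>a' + b'\<close>.\<close>

lemma alpha_add_le: "alpha (a + b) \<le> alpha a + alpha b"
proof (induction a arbitrary: b rule: less_induct)
  case (less a)
  define a' p where "a' = a div 2" and "p = a mod 2"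
  hence a: "a = 2 * a' + p" "p = 0 \<or> p = 1" by auto
  define b' q where "b' = b div 2" and "q = b mod 2"
  hence b: "b = 2 * b' + q" "q = 0 \<or> q = 1" by auto
  show ?case
  \<comment> \<open>Halving decreases \<open>a\<close> unless \<open>a = 0\<close>, so the values 0
    and 1 of \<open>a\<close> are treated separately.\<close>
  proof (cases "a' = 0")
    case True
    thus ?thesis using a alpha_Suc_le[of b] alpha_Suc_double[of 0] by (auto simp: alpha_0)
  next
    case False
    hence IH: "alpha (a' + b') \<le> alpha a' + alpha b'" using a by (intro less.IH) auto
    have "alpha a = alpha a' + p" "alpha b = alpha b' + q"
      using a b by (auto simp: alpha_double alpha_Suc_double)
    moreover have "alpha (a + b) \<le> alpha (a' + b') + p + q"
    proof (cases "p = 1 \<and> q = 1")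
      case True
      hence "a + b = 2 * Suc (a' + b')" using a b by simp
      thus ?thesis using True alpha_Suc_le[of "a' + b'"] by (simp only: alpha_double)
    next
      case False
      hence "a + b = 2 * (a' + b') \<and> p + q = 0 \<or> a + b = Suc (2 * (a' + b')) \<and> p + q = 1"
        using a b by auto
      thus ?thesis by (elim disjE) (simp_all only: alpha_double alpha_Suc_double, simp_all)
    qed
    ultimately show ?thesis using IH by simp
  qed
qed

lemma alpha_le: "alpha t \<le> t"
proof (induction t)
  case (Suc t)
  thus ?case using alpha_Suc_le[of t] by simp
qed (simp add: alpha_0)

lemma alpha_power2: "alpha (2 ^ i) = 1"
  using alpha_Suc_double[of 0] by (induction i) (auto simp: alpha_double alpha_0)

lemma alpha_sum_powers_le: "alpha (\<Sum>j = 1..s. 2 ^ i j) \<le> s"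
proof (induction s)
  case (Suc s)
  thus ?case using alpha_add_le[of "\<Sum>j = 1..s. 2 ^ i j" "2 ^ i (Suc s)"] by (simp add: alpha_power2)
qed (simp add: alpha_0)

text \<open>The argument is the binary expansion of \<open>a\<close> followed by \<open>m\<close>
  ones.\<close>

lemma alpha_append_ones: "alpha (a * 2 ^ m + (2 ^ m - 1)) = alpha a + m"
proof (induction m)
  case (Suc m)
  have "a * 2 ^ Suc m + (2 ^ Suc m - 1) = Suc (2 * (a * 2 ^ m + (2 ^ m - 1)))"
    by (cases "2 ^ m :: nat") (simp_all add: algebra_simps)
  thus ?case using Suc by (simp only: alpha_Suc_double)
qed simp

text \<open>The minimum in \<open>beta\<close> is attained because some \<open>s\<close> qualifies:
  \<open>d\<close> is the sum of \<open>d\<close> copies of 2^1 - 1.\<close>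

lemma beta_sum: "\<exists>i :: nat \<Rightarrow> nat. d = (\<Sum>j = 1..beta d. 2 ^ i j - 1)"
  unfolding beta_def by (rule LeastI[of _ d]) (rule exI[of _ "\<lambda>_. 1"], simp)

text \<open>Adding 1 to each of the \<open>beta d\<close> summands turns \<open>d\<close> into a sum
  of \<open>beta d\<close> powers of 2.\<close>

lemma alpha_add_beta_le: "alpha (d + beta d) \<le> beta d"
proof -
  obtain i :: "nat \<Rightarrow> nat" where d: "d = (\<Sum>j = 1..beta d. 2 ^ i j - 1)"
    using beta_sum by blast
  have "d + beta d = (\<Sum>j = 1..beta d. 2 ^ i j - 1) + (\<Sum>j = 1..beta d. 1)"
    using d by simp
  also have "\<dots> = (\<Sum>j = 1..beta d. 2 ^ i j)"
    unfolding sum.distrib[symmetric] by (intro sum.cong) auto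
  finally show ?thesis using alpha_sum_powers_le by metis
qed

text \<open>If \<open>beta d\<close> were at most \<open>n\<close>, passing from
  \<open>d + beta d\<close> to \<open>d + n\<close> would add only \<open>n - beta d\<close>, a
  number with at most that many digits 1.\<close>

lemma less_betaI:
  assumes "n < alpha (d + n)"
  shows "n < beta d"
proof (rule ccontr)
  assume "\<not> n < beta d"
  hence eq: "d + n = (d + beta d) + (n - beta d)" by simp
  have "alpha (d + n) \<le> beta d + (n - beta d)"
    unfolding eq using alpha_add_le[of "d + beta d" "n - beta d"] alpha_add_beta_le[of d]
      alpha_le[of "n - beta d"] by linarith
  thus False using assms \<open>\<not> n < beta d\<close> by simp
qed

lemma less_beta:
  assumes "alpha (n - 2) \<ge> 3" "k = n - 3" "d = (n - 1) * (2 ^ (k + 1) - 2) + k"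
  shows "n < beta d"
proof (rule less_betaI)
  have n: "n \<ge> 5" using assms(1) alpha_le[of "n - 2"] by linarith
  define p where "p = n - 2"
  have np: "n = p + 2" "k = p - 1" "k + 1 = p" using n assms(2) by (auto simp: p_def)
  have pw: "2 ^ p \<ge> (2 :: nat)" using n np power_increasing[of 1 p "2 :: nat"] by simp
  \<comment> \<open>Writing 2^p - 2 as \<open>c\<close> removes the truncated subtraction from the
    computation of \<open>d + n\<close>.\<close>
  then obtain c :: nat where c: "2 ^ p = c + 2" by (metis add.commute le_Suc_ex)
  have sum: "d + n = p * 2 ^ p + (2 ^ p - 1)"
    unfolding assms(3) np(3) using np n by (simp add: c algebra_simps)
  have "alpha (d + n) = alpha p + p"
    unfolding sum by (rule alpha_append_ones)
  thus "n < alpha (d + n)" using assms(1) np(1) by simp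
qed

section \<open>The power operations on monomials\<close>

abbreviation monom :: "(mvar \<Rightarrow>\<^sub>0 nat) \<Rightarrow> mpoly" where
  "monom m \<equiv> Poly_Mapping.single m 1"

text \<open>Monomials are built up one variable at a time, to match the Cartan formula for a product
  whose second factor is a variable.\<close>

lemma mono_induct [consumes 1, case_names zero add]:
  fixes m :: "'a \<Rightarrow>\<^sub>0 nat"
  assumes "Poly_Mapping.keys m \<subseteq> V" and zero: "S 0"
    and add: "\<And>m v. Poly_Mapping.keys m \<subseteq> V \<Longrightarrow> v \<in> V \<Longrightarrow> S m \<Longrightarrow> S (m + Poly_Mapping.single v 1)"
  shows "S m"
proof -
  let ?T = "\<lambda>m. Poly_Mapping.keys m \<subseteq> V \<and> S m"
  have step: "?T (m + Poly_Mapping.single v k)" if "?T m" "v \<in> V" for m v k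
  proof (induction k)
    case 0
    show ?case using that by simp
  next
    case (Suc k)
    have "m + Poly_Mapping.single v (Suc k) = m + Poly_Mapping.single v k + Poly_Mapping.single v 1"
      by (simp add: add.assoc flip: single_add)
    moreover have "Poly_Mapping.keys (m + Poly_Mapping.single v k + Poly_Mapping.single v 1) \<subseteq> V"
      using Suc that(2) Poly_Mapping.keys_add[of "m + Poly_Mapping.single v k" "Poly_Mapping.single v 1"]
      by (auto split: if_splits)
    ultimately show ?case using add Suc that(2) by metis
  qed
  have "A \<subseteq> V \<Longrightarrow> ?T (\<Sum>v\<in>A. Poly_Mapping.single v (Poly_Mapping.lookup m v))" if "finite A" for A
    using that
  proof (induction A rule: finite_induct)
    case (insert v A)
    thus ?case using step[of "\<Sum>v\<in>A. Poly_Mapping.single v (Poly_Mapping.lookup m v)" v]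
      by (simp add: add.commute[of "Poly_Mapping.single _ _"])
  qed (simp add: zero)
  moreover have "m = (\<Sum>v\<in>Poly_Mapping.keys m. Poly_Mapping.single v (Poly_Mapping.lookup m v))"
    by (rule poly_mapping_eqI) (auto simp: lookup_sum lookup_single when_def in_keys_iff)
  ultimately show ?thesis using assms(1) finite_keys by metis
qed

text \<open>Multiplication by a monomial shifts the coefficients. Together with the next lemma,
  which covers the monomials not divisible by \<open>s\<close>, this computes all coefficients of
  the product.\<close>

lemma lookup_times_monom: "Poly_Mapping.lookup (p * monom s) (m + s) = Poly_Mapping.lookup p m"
proof -
  have "p * monom s = (\<Sum>k\<in>Poly_Mapping.keys p. monom (k + s))"
    by (subst mpoly_eq_sum[of p]) (simp add: sum_distrib_right mult_single)
  hence "Poly_Mapping.lookup (p * monom s) (m + s) = (\<Sum>k\<in>Poly_Mapping.keys p. Poly_Mapping.lookup (monom k) m)"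
    by (simp add: lookup_sum lookup_single)
  also have "\<dots> = Poly_Mapping.lookup (\<Sum>k\<in>Poly_Mapping.keys p. monom k) m"
    by (simp add: lookup_sum)
  finally show ?thesis by (simp flip: mpoly_eq_sum)
qed

lemma lookup_times_monom_eq_0:
  assumes "Poly_Mapping.lookup m v < Poly_Mapping.lookup s v"
  shows "Poly_Mapping.lookup (p * monom s) m = 0"
proof (rule ccontr)
  assume "Poly_Mapping.lookup (p * monom s) m \<noteq> 0"
  hence "m \<in> Poly_Mapping.keys (p * monom s)" by (simp add: in_keys_iff)
  then obtain k where "m = k + s" using keys_mult[of p "monom s"] by (auto split: if_splits)
  thus False using assms by (simp add: lookup_add)
qed

lemma monom_add_Var: "monom (m + Poly_Mapping.single v 1) = monom m * Var v"
  by (simp add: Var_def mult_single)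

text \<open>On a variable only wp^0 and, for y_i, also wp^1 are nonzero, so at most two terms of the
  Cartan sum remain. The \<open>tau\<close> correction survives only for x_i, the only kind of
  variable on which Q_0 is nonzero.\<close>

lemma pow_op_times_Var:
  "pow_op a (p * Var VTau) = pow_op a p * Var VTau"
  "pow_op a (p * Var (VX i)) = pow_op a p * Var (VX i) +
    (if a = 0 then 0 else qpow_op (a - 1) p * Var (VY i) * Var VTau)"
  "pow_op a (p * Var (VY i)) = pow_op a p * Var (VY i) +
    (if a = 0 then 0 else pow_op (a - 1) p * Var (VY i) ^ 2)"
proof -
  have s0: "(\<Sum>b\<in>A. f b * (if b = 0 then c else 0)) = (if (0::nat) \<in> A then f 0 * c else 0)"
    if "finite A" for A f and c :: mpoly
    using that by (simp add: if_distrib[of "\<lambda>x. _ * x"] cong: if_cong)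
  have s1: "(\<Sum>b\<le>a. f b * (if b = 0 then c else if b = 1 then c' else 0)) =
      f 0 * c + (if a = 0 then 0 else f (1 :: nat) * c')" for f and c c' :: mpoly
  proof (cases a)
    case (Suc a')
    have "{..a} = insert 0 (insert 1 {2..a})" using Suc by auto
    thus ?thesis using Suc by (simp add: sum.neutral)
  qed simp
  show "pow_op a (p * Var VTau) = pow_op a p * Var VTau"
    unfolding pow_op_mult op_Var by (simp add: s0)
  show "pow_op a (p * Var (VX i)) = pow_op a p * Var (VX i) +
    (if a = 0 then 0 else qpow_op (a - 1) p * Var (VY i) * Var VTau)"
    unfolding pow_op_mult op_Var by (simp add: s0 ac_simps)
  show "pow_op a (p * Var (VY i)) = pow_op a p * Var (VY i) +
    (if a = 0 then 0 else pow_op (a - 1) p * Var (VY i) ^ 2)"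
    unfolding pow_op_mult op_Var by (simp add: s1)
qed

text \<open>In the variables of \<open>mvars n\<close>, these monomials represent a basis of M_n
  modulo \<open>tau\<close>; all later arguments look at their coefficients only.\<close>

definition reduced :: "(mvar \<Rightarrow>\<^sub>0 nat) \<Rightarrow> bool" where
  "reduced m \<longleftrightarrow> Poly_Mapping.lookup m VTau = 0 \<and> (\<forall>i. Poly_Mapping.lookup m (VX i) \<le> 1)"

lemma reduced_addD: "reduced (m + m') \<Longrightarrow> reduced m"
  unfolding reduced_def by (metis add_leE lookup_add zero_eq_add_iff_both_eq_0)

definition ydeg :: "nat \<Rightarrow> (mvar \<Rightarrow>\<^sub>0 nat) \<Rightarrow> nat" where
  "ydeg n m = (\<Sum>i = 1..n. Poly_Mapping.lookup m (VY i))"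

lemma ydeg_add: "ydeg n (m + m') = ydeg n m + ydeg n m'"
  by (simp add: ydeg_def lookup_add sum.distrib)

lemma ydeg_single: "ydeg n (Poly_Mapping.single v c) = (if v \<in> VY ` {1..n} then c else 0)"
proof (cases "v \<in> VY ` {1..n}")
  case True
  then obtain j where "j \<in> {1..n}" "v = VY j" by blast
  thus ?thesis by (simp add: ydeg_def lookup_single when_def)
next
  case False
  thus ?thesis by (auto simp: ydeg_def lookup_single when_def intro!: sum.neutral)
qed

lemma of_bool_add_bit: "(of_bool A :: bit) + of_bool B = of_bool (A \<noteq> B)"
  by (cases A; cases B) auto

lemma mono_split:
  fixes m :: "mvar \<Rightarrow>\<^sub>0 nat"
  assumes "Poly_Mapping.lookup m v \<ge> c"
  obtains m' where "m = m' + Poly_Mapping.single v c"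
proof
  show "m = (m - Poly_Mapping.single v c) + Poly_Mapping.single v (c :: nat)"
    by (rule poly_mapping_eqI) (use assms in \<open>auto simp: lookup_add lookup_minus lookup_single when_def\<close>)
qed

text \<open>
  The monomial $y^{e'}$ occurs in the total power $y^e (1 + y)^e$ of $y^e$.
\<close>

definition odd_shift :: "nat \<Rightarrow> nat \<Rightarrow> bool" where
  "odd_shift e e' \<longleftrightarrow> e \<le> e' \<and> odd (e choose (e' - e))"

text \<open>Passing from \<open>e\<close> to \<open>Suc e\<close> multiplies y^e (1 + y)^e by y +
  y^2; the last equivalence is Pascal's rule modulo 2.\<close>

lemma odd_shift_simps:
  "odd_shift 0 e' \<longleftrightarrow> e' = 0"
  "\<not> odd_shift (Suc e) 0"
  "odd_shift (Suc e) (Suc 0) \<longleftrightarrow> odd_shift e 0"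
  "odd_shift (Suc e) (Suc (Suc e')) \<longleftrightarrow> odd_shift e (Suc e') \<noteq> odd_shift e e'"
proof -
  show "odd_shift 0 e' \<longleftrightarrow> e' = 0" by (cases e') (auto simp: odd_shift_def)
  show "\<not> odd_shift (Suc e) 0" "odd_shift (Suc e) (Suc 0) \<longleftrightarrow> odd_shift e 0" by (auto simp: odd_shift_def)
  consider "e \<le> e'" | "e = Suc e'" | "e > Suc e'" by linarith
  thus "odd_shift (Suc e) (Suc (Suc e')) \<longleftrightarrow> odd_shift e (Suc e') \<noteq> odd_shift e e'"
    by cases (auto simp: odd_shift_def Suc_diff_le)
qed

text \<open>Modulo \<open>tau\<close>, the total power fixes each x_i and sends y_i to y_i + y_i^2.
  The relation says that \<open>m'\<close> occurs in the total power of \<open>m\<close>, and the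
  condition on \<open>ydeg\<close> selects the component wp^a.\<close>

definition pow_rel :: "nat \<Rightarrow> nat \<Rightarrow> (mvar \<Rightarrow>\<^sub>0 nat) \<Rightarrow> (mvar \<Rightarrow>\<^sub>0 nat) \<Rightarrow> bool" where
  "pow_rel n a m m' \<longleftrightarrow> Poly_Mapping.lookup m VTau = 0 \<and>
     (\<forall>i. Poly_Mapping.lookup m (VX i) = Poly_Mapping.lookup m' (VX i)) \<and>
     (\<forall>i. odd_shift (Poly_Mapping.lookup m (VY i)) (Poly_Mapping.lookup m' (VY i))) \<and>
     ydeg n m' = ydeg n m + a"

text \<open>Induction on the factors of \<open>m\<close>. A factor \<open>tau\<close> makes both
  sides zero. A factor x_i just multiplies, because the Q_0 correction carries a \<open>tau\<close>
  and is invisible on reduced monomials. A factor y_i contributes y_i + y_i^2, which is the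
  recursion of \<open>odd_shift\<close>.\<close>

lemma lookup_pow_op:
  assumes "Poly_Mapping.keys m \<subseteq> mvars n" "reduced m'"
  shows "Poly_Mapping.lookup (pow_op a (monom m)) m' = of_bool (pow_rel n a m m')"
  using assms
proof (induction m arbitrary: m' a rule: mono_induct)
  case zero
  have "pow_rel n a 0 m' \<longleftrightarrow> m' = 0 \<and> a = 0"
  proof
    assume r: "pow_rel n a 0 m'"
    have "m' = 0"
    proof (rule poly_mapping_eqI)
      fix v show "Poly_Mapping.lookup m' v = Poly_Mapping.lookup 0 v"
        using r zero by (cases v) (auto simp: pow_rel_def reduced_def odd_shift_simps)
    qed
    thus "m' = 0 \<and> a = 0" using r by (auto simp: pow_rel_def)
  qed (auto simp: pow_rel_def odd_shift_def)
  thus ?case by (simp add: op_1 lookup_one when_def)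
next
  case (add m v)
  note r = add.prems
  have Tau: "Poly_Mapping.lookup (p * Var VTau) m' = 0" for p
    unfolding Var_def using r by (intro lookup_times_monom_eq_0[of _ VTau]) (simp add: reduced_def)
  have "v = VTau \<or> (\<exists>i. v = VX i) \<or> (\<exists>i. v = VY i \<and> i \<in> {1..n})"
    using add.hyps(2) by (auto simp: mvars_def)
  then consider "v = VTau" | i where "v = VX i" | i where "v = VY i" "i \<in> {1..n}" by blast
  thus ?case
  proof cases
    case 1
    thus ?thesis
      by (simp add: monom_add_Var pow_op_times_Var Tau pow_rel_def lookup_add del: One_nat_def)
  next
    case (2 i)
    have eq: "Poly_Mapping.lookup (pow_op a (monom (m + Poly_Mapping.single v 1))) m' =
        Poly_Mapping.lookup (pow_op a (monom m) * Var (VX i)) m'"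
      unfolding monom_add_Var 2 pow_op_times_Var by (simp add: lookup_add Tau)
    show ?thesis
    proof (cases "Poly_Mapping.lookup m' (VX i) = 0")
      case True
      have "\<not> pow_rel n a (m + Poly_Mapping.single v 1) m'"
      proof
        assume "pow_rel n a (m + Poly_Mapping.single v 1) m'"
        hence "Poly_Mapping.lookup (m + Poly_Mapping.single v 1) (VX i) = 0"
          unfolding pow_rel_def using True by metis
        thus False using 2 by (simp add: lookup_add)
      qed
      moreover have "Poly_Mapping.lookup (pow_op a (monom m) * Var (VX i)) m' = 0"
        unfolding Var_def using True by (intro lookup_times_monom_eq_0[of _ "VX i"]) simp
      ultimately show ?thesis using eq by simp
    next
      case False
      then obtain m'' where m'': "m' = m'' + Poly_Mapping.single (VX i) 1"
        by (elim mono_split[of 1 m' "VX i", rotated]) auto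
      have "reduced m''" using r unfolding m'' by (rule reduced_addD)
      hence "Poly_Mapping.lookup (pow_op a (monom m) * Var (VX i)) m' = of_bool (pow_rel n a m m'')"
        unfolding Var_def m'' lookup_times_monom by (rule add.IH)
      moreover have "pow_rel n a (m + Poly_Mapping.single v 1) m' \<longleftrightarrow> pow_rel n a m m''"
        by (auto simp: pow_rel_def 2 m'' lookup_add lookup_single when_def ydeg_add ydeg_single)
      ultimately show ?thesis using eq by simp
    qed
  next
    case (3 i)
    define e where "e = Poly_Mapping.lookup m (VY i)"
    define A where "A m' \<longleftrightarrow> Poly_Mapping.lookup m VTau = 0 \<and>
     (\<forall>i. Poly_Mapping.lookup m (VX i) = Poly_Mapping.lookup m' (VX i)) \<and>
     (\<forall>j. j \<noteq> i \<longrightarrow> odd_shift (Poly_Mapping.lookup m (VY j)) (Poly_Mapping.lookup m' (VY j)))" for m'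
    have A_add: "A (m' + Poly_Mapping.single (VY i) c) = A m'" for m' c
      by (auto simp: A_def lookup_add lookup_single when_def)
    have rel: "pow_rel n a m m' \<longleftrightarrow> A m' \<and> odd_shift e (Poly_Mapping.lookup m' (VY i)) \<and> ydeg n m' = ydeg n m + a" for m' a
      unfolding pow_rel_def A_def e_def by metis
    have rel1: "pow_rel n a (m + Poly_Mapping.single v 1) m' \<longleftrightarrow>
        A m' \<and> odd_shift (Suc e) (Poly_Mapping.lookup m' (VY i)) \<and> ydeg n m' = Suc (ydeg n m + a)" for m' a
      unfolding pow_rel_def A_def e_def using 3
      by (auto simp: lookup_add lookup_single when_def ydeg_add ydeg_single)
    have eq: "Poly_Mapping.lookup (pow_op a (monom (m + Poly_Mapping.single v 1))) m' =
        Poly_Mapping.lookup (pow_op a (monom m) * monom (Poly_Mapping.single (VY i) 1)) m' +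
        (if a = 0 then 0 else Poly_Mapping.lookup (pow_op (a - 1) (monom m) * monom (Poly_Mapping.single (VY i) 2)) m')"
      unfolding monom_add_Var 3 pow_op_times_Var Var_power by (simp add: lookup_add Var_def)
    consider "Poly_Mapping.lookup m' (VY i) = 0" | "Poly_Mapping.lookup m' (VY i) = 1"
      | "Poly_Mapping.lookup m' (VY i) \<ge> 2" by linarith
    thus ?thesis
    proof cases
      case 1
      thus ?thesis unfolding eq rel1
        by (simp add: lookup_times_monom_eq_0[of _ "VY i"] odd_shift_simps)
    next
      case c: 2
      then obtain m'' where m'': "m' = m'' + Poly_Mapping.single (VY i) 1"
        by (elim mono_split[of 1 m' "VY i", rotated]) auto
      have "reduced m''" using r unfolding m'' by (rule reduced_addD)
      hence "Poly_Mapping.lookup (pow_op a (monom m) * monom (Poly_Mapping.single (VY i) 1)) m' = of_bool (pow_rel n a m m'')"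
        unfolding m'' lookup_times_monom by (rule add.IH)
      moreover have "Poly_Mapping.lookup (p * monom (Poly_Mapping.single (VY i) 2)) m' = 0" for p
        using c by (intro lookup_times_monom_eq_0[of _ "VY i"]) simp
      moreover have "Poly_Mapping.lookup m'' (VY i) = 0" using c by (simp add: m'' lookup_add)
      moreover have "ydeg n m' = Suc (ydeg n m'')" using 3 by (simp add: m'' ydeg_add ydeg_single)
      moreover have "A m' = A m''" by (simp only: m'' A_add)
      ultimately show ?thesis unfolding eq rel1 rel
        using c by (simp add: odd_shift_simps)
    next
      case c: 3
      then obtain m'' where m'': "m' = m'' + Poly_Mapping.single (VY i) 2"
        by (elim mono_split[of 2 m' "VY i", rotated]) auto
      have m1: "m' = (m'' + Poly_Mapping.single (VY i) 1) + Poly_Mapping.single (VY i) 1"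
        by (simp add: m'' add.assoc numeral_2_eq_2 flip: single_add)
      have "reduced m''" "reduced (m'' + Poly_Mapping.single (VY i) 1)"
        using r m'' m1 reduced_addD by metis+
      note IH = this[THEN add.IH]
      have l1: "Poly_Mapping.lookup (pow_op a (monom m) * monom (Poly_Mapping.single (VY i) 1)) m' = of_bool (pow_rel n a m (m'' + Poly_Mapping.single (VY i) 1))"
        unfolding m1 lookup_times_monom by (rule IH)
      have l2: "Poly_Mapping.lookup (pow_op (a - 1) (monom m) * monom (Poly_Mapping.single (VY i) 2)) m' = of_bool (pow_rel n (a - 1) m m'')"
        unfolding m'' lookup_times_monom by (rule IH)
      define e' where "e' = Poly_Mapping.lookup m'' (VY i)"
      have l: "Poly_Mapping.lookup m' (VY i) = Suc (Suc e')" "Poly_Mapping.lookup (m'' + Poly_Mapping.single (VY i) 1) (VY i) = Suc e'"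
        by (simp_all add: m'' e'_def lookup_add)
      have yd: "ydeg n m' = Suc (Suc (ydeg n m''))" "ydeg n (m'' + Poly_Mapping.single (VY i) 1) = Suc (ydeg n m'')"
        using 3 by (simp_all add: m'' ydeg_add ydeg_single)
      \<comment> \<open>This matters for \<open>a = 0\<close>, where the Cartan formula has no y_i^2
        term: the corresponding summand of Pascal's rule would need \<open>ydeg n m\<close> to
        exceed \<open>ydeg n m''\<close>.\<close>
      have le: "ydeg n m \<le> ydeg n m''" if "A m''" "odd_shift e e'"
        unfolding ydeg_def
      proof (rule sum_mono)
        fix j show "Poly_Mapping.lookup m (VY j) \<le> Poly_Mapping.lookup m'' (VY j)"
          using that unfolding A_def e_def e'_def odd_shift_def by metis
      qed
      have "A m' = A m''" "A (m'' + Poly_Mapping.single (VY i) 1) = A m''" by (simp_all only: m'' A_add)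
      thus ?thesis unfolding eq rel1 l1 l2 rel l yd e'_def[symmetric] odd_shift_simps
        using le by (cases a) (auto simp: of_bool_add_bit simp del: add_bit_eq_xor)
    qed
  qed
qed

section \<open>Binomial coefficients modulo 2 and binary digits\<close>

lemma binomial_parity:
  "odd ((2 * n) choose (2 * m)) \<longleftrightarrow> odd (n choose m)"
  "even ((2 * n) choose Suc (2 * m))"
proof -
  have "(odd ((2 * n) choose (2 * m)) \<longleftrightarrow> odd (n choose m)) \<and> even ((2 * n) choose Suc (2 * m))"
  proof (induction n arbitrary: m)
    case 0
    show ?case by (cases m) auto
  next
    case (Suc n)
    have "odd ((2 * Suc n) choose (2 * m)) \<longleftrightarrow> odd (Suc n choose m)"
      using Suc[of m] Suc[of "m - 1"] by (cases m) auto
    moreover have "even ((2 * Suc n) choose Suc (2 * m))"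
      using Suc[of m] Suc[of "m - 1"] by (cases m) auto
    ultimately show ?case ..
  qed
  thus "odd ((2 * n) choose (2 * m)) \<longleftrightarrow> odd (n choose m)" "even ((2 * n) choose Suc (2 * m))"
    by blast+
qed

text \<open>With \<open>binomial_parity\<close> this is Lucas's theorem modulo 2 for the last binary
  digit; one more application of Pascal's rule gives the odd upper index.\<close>

lemma binomial_parity_Suc:
  "odd (Suc (2 * n) choose (2 * m)) \<longleftrightarrow> odd (n choose m)"
  "odd (Suc (2 * n) choose Suc (2 * m)) \<longleftrightarrow> odd (n choose m)"
  using binomial_parity[of n m] binomial_parity[of n "m - 1"] by (cases m; auto)+

text \<open>Lucas's theorem on the last digits: an even \<open>e\<close> admits only even
  differences, an odd \<open>e\<close> admits both. In the last equivalence the difference is odd,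
  and a carry lowers the half of the target by one.\<close>

lemma odd_shift_double:
  "odd_shift (2 * e) (Suc (2 * e')) \<longleftrightarrow> False"
  "odd_shift (Suc (2 * e)) (Suc (2 * e')) \<longleftrightarrow> odd_shift e e'"
  "odd_shift (2 * e) (2 * e') \<longleftrightarrow> odd_shift e e'"
  "odd_shift (Suc (2 * e)) (2 * Suc e') \<longleftrightarrow> odd_shift e e'"
proof -
  have *: "b \<le> a \<Longrightarrow> 2 * a - 2 * b = 2 * (a - b)" "b \<le> a \<Longrightarrow> Suc (2 * a) - 2 * b = Suc (2 * (a - b))"
    "b \<le> a \<Longrightarrow> 2 * Suc a - Suc (2 * b) = Suc (2 * (a - b))" for a b :: nat
    by auto
  show "odd_shift (2 * e) (Suc (2 * e')) \<longleftrightarrow> False"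
    using binomial_parity(2)[of e "e' - e"] by (cases "e \<le> e'") (auto simp: odd_shift_def *)
  show "odd_shift (Suc (2 * e)) (Suc (2 * e')) \<longleftrightarrow> odd_shift e e'"
    using binomial_parity_Suc(1)[of e "e' - e"] by (cases "e \<le> e'") (auto simp: odd_shift_def *)
  show "odd_shift (2 * e) (2 * e') \<longleftrightarrow> odd_shift e e'"
    using binomial_parity(1)[of e "e' - e"] by (cases "e \<le> e'") (auto simp: odd_shift_def *)
  have "odd_shift (Suc (2 * e)) (2 * Suc e') \<longleftrightarrow> e \<le> e' \<and> odd (Suc (2 * e) choose (2 * Suc e' - Suc (2 * e)))"
    unfolding odd_shift_def by auto
  thus "odd_shift (Suc (2 * e)) (2 * Suc e') \<longleftrightarrow> odd_shift e e'"
    using binomial_parity_Suc(2)[of e "e' - e"] by (cases "e \<le> e'") (simp_all only: odd_shift_def * simp_thms)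
qed

lemma nat_parity_cases:
  obtains f where "e = 2 * f" | f where "e = Suc (2 * (f :: nat))"
  by (metis evenE oddE Suc_eq_plus1)

text \<open>All digits of 2^k - 1 are ones, and an odd target forces an odd source; halving repeats
  the argument. This is the classical fact that a spike y^(2^k - 1) occurs in no wp^a of another
  power of y.\<close>

lemma odd_shift_full: "odd_shift e (2 ^ k - 1) \<Longrightarrow> e = 2 ^ k - 1"
proof (induction k arbitrary: e)
  case 0
  thus ?case by (simp add: odd_shift_def)
next
  case (Suc k)
  have e': "2 ^ Suc k - 1 = Suc (2 * (2 ^ k - 1 :: nat))" by (cases "2 ^ k :: nat") auto
  obtain f where "e = Suc (2 * f)" "odd_shift f (2 ^ k - 1)"
    using Suc.prems unfolding e' by (cases e rule: nat_parity_cases) (simp_all only: odd_shift_double)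
  thus ?case using Suc.IH[of f] e' by simp
qed

text \<open>The target has a single zero digit, at position \<open>s\<close>. The ones below it are
  stripped by halving. At the zero digit either \<open>e\<close> is even and the rest is full, or
  \<open>e\<close> is odd and the zero digit moves up one place.\<close>

lemma odd_shift_full_minus_power:
  assumes "odd_shift e (2 ^ k - 1 - 2 ^ s)" "s < k"
  shows "\<exists>r<k. e = 2 ^ k - 1 - 2 ^ r"
  using assms
proof (induction k arbitrary: e s)
  case (Suc k)
  have T: "2 ^ Suc k - 1 - 2 ^ Suc r = Suc (2 * (2 ^ k - 1 - 2 ^ r :: nat))" if "r < k" for r
  proof -
    have "2 ^ Suc r \<le> (2 :: nat) ^ k" using that by (intro power_increasing) auto
    moreover have "1 \<le> (2 :: nat) ^ r" by simp
    ultimately show ?thesis unfolding power_Suc by arith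
  qed
  have T0: "2 ^ Suc k - 1 - 2 ^ 0 = 2 * (2 ^ k - 1 :: nat)" by simp
  show ?case
  proof (cases s)
    case (Suc s')
    hence s': "s' < k" using Suc.prems by simp
    obtain f where f: "e = Suc (2 * f)" "odd_shift f (2 ^ k - 1 - 2 ^ s')"
      using Suc.prems(1) unfolding Suc T[OF s']
      by (cases e rule: nat_parity_cases) (simp_all only: odd_shift_double)
    then obtain r where "r < k" "f = 2 ^ k - 1 - 2 ^ r" using Suc.IH s' by blast
    thus ?thesis using T[of r] f(1) by (intro exI[of _ "Suc r"]) simp
  next
    case 0
    show ?thesis
    proof (cases e rule: nat_parity_cases)
      case (1 f)
      hence "odd_shift f (2 ^ k - 1)" using Suc.prems(1) unfolding 0 T0 by (simp only: odd_shift_double)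
      hence "f = 2 ^ k - 1" by (rule odd_shift_full)
      thus ?thesis using 1 T0 by (intro exI[of _ 0]) simp
    next
      case (2 f)
      \<comment> \<open>For \<open>k = 0\<close> the target is 0, which an odd \<open>e\<close>
        exceeds.\<close>
      have "k \<noteq> 0"
      proof
        assume "k = 0"
        thus False using Suc.prems 2 by (simp add: odd_shift_def)
      qed
      hence "2 ^ 1 \<le> (2 :: nat) ^ k" by (intro power_increasing) auto
      \<comment> \<open>The successor exposes the carry: the halved target is 2^k - 2, whose zero
        digit is again at position 0.\<close>
      hence pred: "2 * (2 ^ k - 1) = 2 * Suc (2 ^ k - 1 - 2 ^ 0 :: nat)" by simp
      have "odd_shift f (2 ^ k - 1 - 2 ^ 0)"
        using Suc.prems(1) unfolding 0 T0 2 pred odd_shift_double .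
      then obtain r where "r < k" "f = 2 ^ k - 1 - 2 ^ r" using Suc.IH \<open>k \<noteq> 0\<close> by blast
      thus ?thesis using T[of r] 2 by (intro exI[of _ "Suc r"]) simp
    qed
  qed
qed simp

section \<open>A functional that vanishes on the images of the operations\<close>

abbreviation "xexp m i \<equiv> Poly_Mapping.lookup m (VX i)"
abbreviation "yexp m i \<equiv> Poly_Mapping.lookup m (VY i)"

text \<open>The bijection sigma of the overview is encoded by the exponents 2^k - 1 - 2^sigma(i)
  themselves, which determine sigma because these values are distinct.\<close>

definition detected :: "nat \<Rightarrow> nat \<Rightarrow> (mvar \<Rightarrow>\<^sub>0 nat) \<Rightarrow> bool" where
  "detected n k m \<longleftrightarrow> reduced m \<and> (\<forall>i\<in>{1..n}. xexp m i = 0 \<longrightarrow> yexp m i = 2 ^ k - 1) \<and>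
     bij_betw (yexp m) {i\<in>{1..n}. xexp m i = 1} ((\<lambda>s. 2 ^ k - 1 - 2 ^ s) ` {..<k})"

text \<open>This is the functional theta o Q_0 ... Q_{k-1} of the overview, given by its values on
  monomials. The coefficient is kept as a factor so that additivity follows from
  \<open>setsum_keys_plus_distrib\<close>.\<close>

definition detector :: "nat \<Rightarrow> nat \<Rightarrow> mpoly \<Rightarrow> bit" where
  "detector n k p = (\<Sum>m\<in>Poly_Mapping.keys p. Poly_Mapping.lookup p m * of_bool (detected n k m))"

lemma detector_add: "detector n k (p + q) = detector n k p + detector n k q"
  unfolding detector_def by (rule setsum_keys_plus_distrib) (simp_all only: distrib_right mult_zero_left)

lemma detector_0: "detector n k 0 = 0" by (simp add: detector_def)

lemma detector_sum: "detector n k (sum f A) = (\<Sum>i\<in>A. detector n k (f i))"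
  by (induction A rule: infinite_finite_induct) (simp_all add: detector_add detector_0 del: add_bit_eq_xor)

lemma detector_monom: "detector n k (monom m) = of_bool (detected n k m)"
  by (simp add: detector_def)

text \<open>Vanishing becomes the evenness of a count, which pairings of monomials can
  prove.\<close>

lemma detector_card: "detector n k p = of_nat (card {m \<in> Poly_Mapping.keys p. detected n k m})"
proof -
  have "detector n k p = (\<Sum>m\<in>Poly_Mapping.keys p. of_bool (detected n k m))"
    unfolding detector_def by (rule sum.cong) (simp_all add: in_keys_iff)
  thus ?thesis by (simp add: sum_of_bool_eq Int_def)
qed

lemma of_nat_even_bit: "even c \<Longrightarrow> (of_nat c :: bit) = 0"
  by (elim evenE) simp

text \<open>No monomial of the product is detected, since its exponent at \<open>v\<close> is too
  large. This applies to multiples of \<open>tau\<close> and of x_i^2.\<close>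

lemma detector_eq_0:
  assumes "\<And>m. detected n k m \<Longrightarrow> Poly_Mapping.lookup m v < Poly_Mapping.lookup s v"
  shows "detector n k (p * monom s) = 0"
  unfolding detector_def
  by (rule sum.neutral) (use assms lookup_times_monom_eq_0[of _ v s p] in auto)

lemma detector_tau: "detector n k (p * Var VTau) = 0"
  unfolding Var_def by (rule detector_eq_0[of _ _ VTau]) (simp add: detected_def reduced_def)

lemma detector_x_square: "detector n k (p * Var (VX i) ^ 2) = 0"
  unfolding Var_power
  by (rule detector_eq_0[of _ _ "VX i"]) (auto simp: detected_def reduced_def less_Suc_eq_le numeral_2_eq_2)

section \<open>The exchange of two indices\<close>

fun swap_var :: "nat \<Rightarrow> nat \<Rightarrow> mvar \<Rightarrow> mvar" where
  "swap_var i j VTau = VTau"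
| "swap_var i j (VX l) = VX (Transposition.transpose i j l)"
| "swap_var i j (VY l) = VY (Transposition.transpose i j l)"

text \<open>\<open>map_key\<close> precomposes the exponents with the renaming; as the renaming is
  an involution, this is the same as substituting variables.\<close>

definition swap :: "nat \<Rightarrow> nat \<Rightarrow> (mvar \<Rightarrow>\<^sub>0 nat) \<Rightarrow> (mvar \<Rightarrow>\<^sub>0 nat)" where
  "swap i j = Poly_Mapping.map_key (swap_var i j)"

lemma swap_var_swap_var: "swap_var i j (swap_var i j v) = v"
  by (cases v) auto

lemma lookup_swap: "Poly_Mapping.lookup (swap i j m) v = Poly_Mapping.lookup m (swap_var i j v)"
proof -
  have "inj (swap_var i j)" by (rule inj_on_inverseI[of _ "swap_var i j"]) (simp add: swap_var_swap_var)
  thus ?thesis by (simp add: swap_def map_key.rep_eq)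
qed

lemma swap_swap: "swap i j (swap i j m) = m"
  by (rule poly_mapping_eqI) (simp add: lookup_swap swap_var_swap_var)

lemma transpose_in_iff:
  assumes "i \<in> {1..n}" "j \<in> {1..n}"
  shows "Transposition.transpose i j l \<in> {1..n} \<longleftrightarrow> l \<in> {1..n}"
  using assms by (auto simp: Transposition.transpose_def)

text \<open>The conditions are symmetric in the indices from 1 to \<open>n\<close>: the bijection is
  composed with the transposition.\<close>

lemma detected_swap:
  assumes "i \<in> {1..n}" "j \<in> {1..n}" "detected n k m"
  shows "detected n k (swap i j m)"
proof -
  let ?t = "Transposition.transpose i j"
  note t = transpose_in_iff[OF assms(1,2)]
  have "bij_betw ?t {l \<in> {1..n}. xexp m (?t l) = 1} {l \<in> {1..n}. xexp m l = 1}"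
    by (rule bij_betw_byWitness[of _ ?t]) (auto simp: t[unfolded One_nat_def] simp del: atLeastAtMost_iff)
  hence "bij_betw (yexp m \<circ> ?t) {l \<in> {1..n}. xexp m (?t l) = 1} ((\<lambda>s. 2 ^ k - 1 - 2 ^ s) ` {..<k})"
    by (rule bij_betw_trans) (use assms(3) in \<open>simp add: detected_def\<close>)
  thus ?thesis using assms(3)
    by (auto simp: detected_def reduced_def lookup_swap t[unfolded One_nat_def] o_def simp del: atLeastAtMost_iff)
qed

lemma ydeg_swap:
  assumes "i \<in> {1..n}" "j \<in> {1..n}"
  shows "ydeg n (swap i j m) = ydeg n m"
proof -
  have "bij_betw (Transposition.transpose i j) {1..n} {1..n}" using assms by simp
  thus ?thesis unfolding ydeg_def by (simp add: lookup_swap sum.reindex_bij_betw[of _ _ _ "yexp m"])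
qed

text \<open>The values are distinct, and the subtracted powers 2^s with \<open>s < k\<close> add up
  to 2^k - 1. That total is added on the left to keep the equation free of truncated
  subtraction.\<close>

lemma card_full_minus_powers: "card ((\<lambda>s. 2 ^ k - 1 - 2 ^ s :: nat) ` {..<k}) = k"
  and sum_full_minus_powers: "\<Sum>((\<lambda>s. 2 ^ k - 1 - 2 ^ s :: nat) ` {..<k}) + (2 ^ k - 1) = k * (2 ^ k - 1)"
proof -
  have le: "2 ^ s \<le> (2 ^ k - 1 :: nat)" if "s < k" for s
  proof -
    have "2 ^ s < (2 ^ k :: nat)" using that by simp
    thus ?thesis by linarith
  qed
  have inj: "inj_on (\<lambda>s. 2 ^ k - 1 - 2 ^ s :: nat) {..<k}"
  proof (rule inj_onI)
    fix s r assume "s \<in> {..<k}" "r \<in> {..<k}" "2 ^ k - 1 - 2 ^ s = (2 ^ k - 1 - 2 ^ r :: nat)"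
    hence "2 ^ s = (2 ^ r :: nat)" using le[of s] le[of r] by (metis diff_diff_cancel lessThan_iff)
    thus "s = r" by simp
  qed
  show "card ((\<lambda>s. 2 ^ k - 1 - 2 ^ s :: nat) ` {..<k}) = k" using inj by (simp add: card_image)
  have "(\<Sum>s<k. 2 ^ k - 1 - 2 ^ s :: nat) + (\<Sum>s<k. 2 ^ s) = (\<Sum>s<k. 2 ^ k - 1)"
    unfolding sum.distrib[symmetric] by (intro sum.cong le_add_diff_inverse2 le) simp_all
  moreover have "(\<Sum>s<k. 2 ^ s) = (2 ^ k - 1 :: nat)"
    by (induction k) auto
  ultimately show "\<Sum>((\<lambda>s. 2 ^ k - 1 - 2 ^ s :: nat) ` {..<k}) + (2 ^ k - 1) = k * (2 ^ k - 1)"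
    using inj by (simp add: sum.reindex)
qed

text \<open>Indices without an x-factor have full exponent, and the others together miss the sum of
  all 2^s with \<open>s < k\<close>. So all detected monomials share one y-degree, which an
  operation wp^a with \<open>a \<ge> 1\<close> cannot preserve.\<close>

lemma ydeg_detected:
  assumes "detected n k m"
  shows "ydeg n m + (2 ^ k - 1) = n * (2 ^ k - 1)"
proof -
  let ?I = "{i\<in>{1..n}. xexp m i = 1}" and ?T = "(\<lambda>s. 2 ^ k - 1 - 2 ^ s :: nat) ` {..<k}"
  have bij: "bij_betw (yexp m) ?I ?T" using assms by (simp add: detected_def)
  have card: "card ?I = k" using bij_betw_same_card[OF bij] card_full_minus_powers by simp
  have "card ?I \<le> card {1..n}" by (rule card_mono) auto
  hence le: "k \<le> n" using card by simp
  have X01: "xexp m i = 0 \<or> xexp m i = 1" for i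
  proof -
    have "xexp m i \<le> 1" using assms by (simp add: detected_def reduced_def)
    thus ?thesis by linarith
  qed
  have "ydeg n m = (\<Sum>i\<in>{1..n} - ?I. yexp m i) + (\<Sum>i\<in>?I. yexp m i)"
    unfolding ydeg_def by (rule sum.subset_diff) auto
  also have "(\<Sum>i\<in>?I. yexp m i) = \<Sum>?T" using sum.reindex_bij_betw[OF bij, of "\<lambda>x. x"] by simp
  also have "(\<Sum>i\<in>{1..n} - ?I. yexp m i) = (\<Sum>i\<in>{1..n} - ?I. 2 ^ k - 1)"
  proof (rule sum.cong)
    fix i assume "i \<in> {1..n} - ?I"
    thus "yexp m i = 2 ^ k - 1" using assms X01[of i] by (auto simp: detected_def)
  qed simp
  also have "\<dots> = (n - k) * (2 ^ k - 1)"
    unfolding sum_constant using card by (subst card_Diff_subset) auto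
  finally have "ydeg n m + (2 ^ k - 1) = (n - k) * (2 ^ k - 1) + k * (2 ^ k - 1)"
    using sum_full_minus_powers[of k] by linarith
  also have "\<dots> = n * (2 ^ k - 1)" using le by (simp flip: add_mult_distrib)
  finally show ?thesis .
qed

text \<open>If some detected monomial occurs in wp^a of \<open>m\<close>, then \<open>m\<close> has
  equal exponents at two of the indices with an x-factor. Exchanging these indices pairs off the
  detected monomials of the image.\<close>

lemma detector_pow_op:
  assumes m: "Poly_Mapping.keys m \<subseteq> mvars n" and a: "a \<ge> 1"
  shows "detector n k (pow_op a (monom m)) = 0"
proof -
  define S where "S = {m'. detected n k m' \<and> pow_rel n a m m'}"
  have S: "{m' \<in> Poly_Mapping.keys (pow_op a (monom m)). detected n k m'} = S"
    by (auto simp: S_def in_keys_iff lookup_pow_op[OF m] detected_def)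
  have fin: "finite S" unfolding S[symmetric] by simp
  have "even (card S)"
  proof (cases "S = {}")
    case False
    then obtain m' where m': "detected n k m'" "pow_rel n a m m'" by (auto simp: S_def)
    let ?I = "{i\<in>{1..n}. xexp m i = 1}" and ?T = "(\<lambda>s. 2 ^ k - 1 - 2 ^ s :: nat) ` {..<k}"
    have XX: "xexp m'' i = xexp m i" if "pow_rel n a m m''" for m'' i using that by (auto simp: pow_rel_def)
    have bij: "bij_betw (yexp m'') ?I ?T" if "m'' \<in> S" for m''
      using that XX[of m''] by (auto simp: S_def detected_def)
    have red: "reduced m" using m' unfolding reduced_def detected_def pow_rel_def by metis
    \<comment> \<open>By the two digit lemmas \<open>m\<close> inherits the shape of a detected
      monomial, except possibly the distinctness of the exponents on \<open>?I\<close>.\<close>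
    have out: "yexp m i = 2 ^ k - 1" if "i \<in> {1..n}" "xexp m i = 0" for i
    proof -
      have "odd_shift (yexp m i) (yexp m' i)" "xexp m' i = 0" using m' that by (simp_all add: pow_rel_def)
      moreover from this have "yexp m' i = 2 ^ k - 1" using m' that by (simp add: detected_def)
      ultimately show ?thesis using odd_shift_full by metis
    qed
    have into: "yexp m i \<in> ?T" if "i \<in> ?I" for i
    proof -
      have "bij_betw (yexp m') ?I ?T" using bij m' unfolding S_def by blast
      hence "yexp m' i \<in> ?T" using that by (rule bij_betw_apply)
      then obtain s where s: "s < k" "yexp m' i = 2 ^ k - 1 - 2 ^ s" by blast
      have "odd_shift (yexp m i) (2 ^ k - 1 - 2 ^ s)" using m'(2) unfolding pow_rel_def s(2)[symmetric] by blast
      thus ?thesis using odd_shift_full_minus_power s(1) by blast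
    qed
    \<comment> \<open>With distinct exponents \<open>m\<close> would be detected and have the
      y-degree of \<open>m'\<close>, whereas wp^a raises that degree by \<open>a\<close>.\<close>
    have "\<not> inj_on (yexp m) ?I"
    proof
      assume inj: "inj_on (yexp m) ?I"
      have "card (yexp m ` ?I) = card ?T"
        using inj bij_betw_same_card[OF bij, of m'] m' by (simp add: card_image S_def)
      hence "yexp m ` ?I = ?T" using into by (intro card_subset_eq) auto
      hence "detected n k m" using inj red out by (simp add: detected_def bij_betw_def)
      hence "ydeg n m = ydeg n m'" using ydeg_detected[of n k m] ydeg_detected[OF m'(1)] by linarith
      thus False using m'(2) a by (simp add: pow_rel_def)
    qed
    then obtain i j where ij: "i \<in> ?I" "j \<in> ?I" "i \<noteq> j" "yexp m i = yexp m j" by (auto simp: inj_on_def)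
    let ?t = "Transposition.transpose i j"
    \<comment> \<open>The exchange of \<open>i\<close> and \<open>j\<close> fixes \<open>m\<close>,
      hence preserves the set of detected monomials in its image.\<close>
    have swap: "swap i j m'' \<in> S" if "m'' \<in> S" for m''
    proof -
      have "xexp m (?t l) = xexp m l" "yexp m (?t l) = yexp m l" for l
        using ij by (auto simp: Transposition.transpose_def)
      moreover have "pow_rel n a m m''" "detected n k m''" using that by (auto simp: S_def)
      ultimately show ?thesis using ij ydeg_swap[of i n j] detected_swap[of i n j k m'']
        by (simp add: S_def pow_rel_def lookup_swap) metis
    qed
    \<comment> \<open>The exchange has no fixed point on \<open>S\<close>, as a detected monomial
      has different exponents at \<open>i\<close> and \<open>j\<close>; it maps \<open>A\<close>
      onto \<open>B\<close>.\<close>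
    define A where "A = {m'' \<in> S. yexp m'' i < yexp m'' j}"
    define B where "B = {m'' \<in> S. yexp m'' j < yexp m'' i}"
    have "yexp m'' i \<noteq> yexp m'' j" if "m'' \<in> S" for m''
      using bij[OF that] ij by (auto simp: bij_betw_def inj_on_def)
    hence "S = A \<union> B" by (auto simp: A_def B_def neq_iff)
    moreover have "A \<inter> B = {}" by (auto simp: A_def B_def)
    moreover have "bij_betw (swap i j) A B"
      by (rule bij_betw_byWitness[of _ "swap i j"])
        (auto simp: A_def B_def swap swap_swap lookup_swap)
    ultimately have "card S = card A + card A"
      using fin by (simp add: card_Un_disjoint bij_betw_same_card)
    thus ?thesis by simp
  qed simp
  thus ?thesis by (simp add: detector_card S of_nat_even_bit)
qed

section \<open>The operation Q_0 on monomials\<close>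

definition x_to_y :: "(mvar \<Rightarrow>\<^sub>0 nat) \<Rightarrow> nat \<Rightarrow> (mvar \<Rightarrow>\<^sub>0 nat)" where
  "x_to_y m i = m - Poly_Mapping.single (VX i) 1 + Poly_Mapping.single (VY i) 1"

lemma lookup_x_to_y:
  "Poly_Mapping.lookup (x_to_y m i) VTau = Poly_Mapping.lookup m VTau"
  "xexp (x_to_y m i) l = (if l = i then xexp m l - 1 else xexp m l)"
  "yexp (x_to_y m i) l = (if l = i then Suc (yexp m l) else yexp m l)"
  by (auto simp: x_to_y_def lookup_add lookup_minus lookup_single when_def)

text \<open>Q_0 is the derivation with x_i sent to y_i, and the derivative of x_i^e is e x_i^(e-1)
  y_i, so only odd exponents contribute. There the subtraction in \<open>x_to_y\<close> is
  exact.\<close>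

lemma qpow_op_monom:
  assumes "Poly_Mapping.keys m \<subseteq> mvars n"
  shows "qpow_op 0 (monom m) = (\<Sum>i = 1..n. if odd (xexp m i) then monom (x_to_y m i) else 0)"
  using assms
proof (induction m rule: mono_induct)
  case zero
  thus ?case by (simp add: op_1)
next
  case (add m v)
  let ?v = "Poly_Mapping.single v (1 :: nat)"
  have mult: "(if odd (xexp m i) then monom (x_to_y m i) else 0) * Var v =
      (if odd (xexp m i) then monom (x_to_y (m + ?v) i) else 0)" for i
  proof (cases "odd (xexp m i)")
    case True
    hence "xexp m i \<noteq> 0" by (metis even_zero)
    have "x_to_y (m + ?v) i = x_to_y m i + ?v"
    proof (rule poly_mapping_eqI)
      fix w show "Poly_Mapping.lookup (x_to_y (m + ?v) i) w = Poly_Mapping.lookup (x_to_y m i + ?v) w"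
        using \<open>xexp m i \<noteq> 0\<close> by (cases w) (auto simp: lookup_x_to_y lookup_add lookup_single when_def)
    qed
    thus ?thesis using True by (simp only: monom_add_Var if_True simp_thms)
  qed simp
  have Q: "qpow_op 0 (monom (m + ?v)) = (\<Sum>i = 1..n. if odd (xexp m i) then monom (x_to_y (m + ?v) i) else 0)
      + monom m * qpow_op 0 (Var v)"
    unfolding monom_add_Var[of m v] Q_op_mult add.IH sum_distrib_right mult ..
  have no_x: ?case if "qpow_op 0 (Var v) = 0" "\<And>i. xexp ?v i = 0"
    unfolding Q lookup_add that by simp
  show ?case
  proof (cases v)
    case VTau
    show ?thesis by (rule no_x) (simp_all add: VTau op_Var lookup_single when_def)
  next
    case (VY j)
    show ?thesis by (rule no_x) (simp_all add: VY op_Var lookup_single when_def)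
  next
    case (VX j)
    have j: "j \<in> {1..n}" using add.hyps(2) VX by (auto simp: mvars_def)
    have "x_to_y (m + ?v) j = m + Poly_Mapping.single (VY j) 1"
      using VX by (simp add: x_to_y_def)
    hence q: "monom m * qpow_op 0 (Var v) = monom (x_to_y (m + ?v) j)"
      using VX by (simp add: op_Var monom_add_Var del: One_nat_def)
    \<comment> \<open>The factor x_j flips the parity of the exponent at \<open>j\<close>; if that
      exponent was odd in \<open>m\<close>, the two equal terms on the right cancel.\<close>
    have "(\<Sum>i = 1..n. if odd (xexp (m + ?v) i) then monom (x_to_y (m + ?v) i) else 0)
        = (\<Sum>i = 1..n. (if odd (xexp m i) then monom (x_to_y (m + ?v) i) else 0)
            + (if i = j then monom (x_to_y (m + ?v) j) else 0))"
      using VX by (intro sum.cong) (auto simp: lookup_add lookup_single when_def)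
    thus ?thesis unfolding Q q sum.distrib using j by simp
  qed
qed

text \<open>If replacing x_i by y_i gives a detected monomial, then y_i had exponent 2^k - 2 in
  \<open>m\<close>. Exactly one other index \<open>j\<close> with an x-factor has this exponent, the
  one with sigma(j) = 0. Replacing x_j instead gives the exchanged monomial, so exactly two terms
  are detected.\<close>

lemma detector_qpow_op:
  assumes m: "Poly_Mapping.keys m \<subseteq> mvars n" and k: "k \<ge> 1"
  shows "detector n k (qpow_op 0 (monom m)) = 0"
proof -
  define S where "S = {i \<in> {1..n}. odd (xexp m i) \<and> detected n k (x_to_y m i)}"
  have "detector n k (qpow_op 0 (monom m)) = (\<Sum>i = 1..n. of_bool (odd (xexp m i) \<and> detected n k (x_to_y m i)))"
    unfolding qpow_op_monom[OF m] detector_sum by (intro sum.cong) (auto simp: detector_monom detector_0)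
  also have "\<dots> = of_nat (card S)" by (simp add: sum_of_bool_eq Int_def S_def)
  finally have eq: "detector n k (qpow_op 0 (monom m)) = of_nat (card S)" .
  have "even (card S)"
  proof (cases "S = {}")
    case False
    then obtain i where "i \<in> S" by blast
    have S: "l \<in> {1..n}" "xexp m l = 1" "Suc (yexp m l) = 2 ^ k - 1" "detected n k (x_to_y m l)" if "l \<in> S" for l
    proof -
      show l: "l \<in> {1..n}" "detected n k (x_to_y m l)" using that by (auto simp: S_def)
      have "xexp (x_to_y m l) l \<le> 1" using l(2) by (simp add: detected_def reduced_def)
      moreover have "odd (xexp m l)" using that by (simp add: S_def)
      ultimately show "xexp m l = 1" by (auto simp: lookup_x_to_y elim!: oddE)
      hence "xexp (x_to_y m l) l = 0" by (simp add: lookup_x_to_y)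
      hence "yexp (x_to_y m l) l = 2 ^ k - 1" using l by (auto simp: detected_def)
      thus "Suc (yexp m l) = 2 ^ k - 1" by (simp add: lookup_x_to_y)
    qed
    let ?I = "{l \<in> {1..n}. xexp (x_to_y m i) l = 1}"
    have bij: "bij_betw (yexp (x_to_y m i)) ?I ((\<lambda>s. 2 ^ k - 1 - 2 ^ s) ` {..<k})"
      using S(4)[OF \<open>i \<in> S\<close>] by (simp add: detected_def)
    \<comment> \<open>Here \<open>k \<ge> 1\<close> ensures that the value 0 of sigma
      exists.\<close>
    have "2 ^ k - 1 - 2 ^ 0 \<in> (\<lambda>s. 2 ^ k - 1 - 2 ^ s :: nat) ` {..<k}" using k by (intro imageI) auto
    then obtain j where j: "j \<in> ?I" "yexp (x_to_y m i) j = 2 ^ k - 1 - 2 ^ 0"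
      using bij unfolding bij_betw_def by (metis (no_types, lifting) imageE)
    have ij: "i \<noteq> j" using j(1) S(2)[OF \<open>i \<in> S\<close>] by (auto simp: lookup_x_to_y)
    hence j': "xexp m j = 1" "Suc (yexp m j) = 2 ^ k - 1"
      using j S(3)[OF \<open>i \<in> S\<close>] by (auto simp: lookup_x_to_y)
    have "x_to_y m j = swap i j (x_to_y m i)"
    proof (rule poly_mapping_eqI)
      fix w show "Poly_Mapping.lookup (x_to_y m j) w = Poly_Mapping.lookup (swap i j (x_to_y m i)) w"
        using ij j' S(2,3)[OF \<open>i \<in> S\<close>]
        by (cases w) (auto simp: lookup_swap lookup_x_to_y Transposition.transpose_def)
    qed
    hence "j \<in> S" using j j' S(1,4)[OF \<open>i \<in> S\<close>] detected_swap[of i n j k "x_to_y m i"]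
      by (simp add: S_def)
    \<comment> \<open>Any further index would share the exponent 2^k - 2 with \<open>j\<close>,
      against injectivity on \<open>?I\<close>.\<close>
    moreover have "l = j" if "l \<in> S" "l \<noteq> i" for l
    proof -
      have "l \<in> ?I" "yexp (x_to_y m i) l = yexp (x_to_y m i) j"
        using that j' ij S[OF that(1)] by (auto simp: lookup_x_to_y)
      thus ?thesis using bij j(1) unfolding bij_betw_def inj_on_def by blast
    qed
    ultimately have "S = {i, j}" using \<open>i \<in> S\<close> by blast
    thus ?thesis using ij by simp
  qed simp
  thus ?thesis by (simp add: eq of_nat_even_bit)
qed

lemma detector_op:
  assumes "p \<in> polys n"
  shows "k \<ge> 1 \<Longrightarrow> detector n k (qpow_op 0 p) = 0" "a \<ge> 1 \<Longrightarrow> detector n k (pow_op a p) = 0"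
proof -
  have p: "f p = (\<Sum>m\<in>Poly_Mapping.keys p. f (monom m))" if "f = qpow_op 0 \<or> f = pow_op a" for f
    using that mpoly_eq_sum[of p] op_sum by metis
  show "k \<ge> 1 \<Longrightarrow> detector n k (qpow_op 0 p) = 0"
    using assms by (subst p) (auto simp: detector_sum polys_def intro!: sum.neutral detector_qpow_op)
  show "a \<ge> 1 \<Longrightarrow> detector n k (pow_op a p) = 0"
    using assms by (subst p) (auto simp: detector_sum polys_def intro!: sum.neutral detector_pow_op)
qed

section \<open>The functional on $M_n$\<close>

lemma Var_polys [simp]:
  "Var VTau \<in> polys n" "i \<in> {1..n} \<Longrightarrow> Var (VX i) \<in> polys n" "i \<in> {1..n} \<Longrightarrow> Var (VY i) \<in> polys n"
  by (rule polys_closed(3); simp add: mvars_def)+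

text \<open>The polynomials all of whose multiples are killed form an ideal. It contains each
  generator because multiples of x_i^2 and multiples of \<open>tau\<close> are killed
  separately.\<close>

lemma detector_rel_ideal:
  assumes "p \<in> rel_ideal n"
  shows "detector n k p = 0"
proof -
  interpret P: cring "poly_ring n" by (rule poly_ring_cring)
  let ?J = "{p \<in> polys n. \<forall>q\<in>polys n. detector n k (q * p) = 0}"
  have "ideal ?J (poly_ring n)"
  proof (rule idealI)
    show "ring (poly_ring n)" ..
    show "subgroup ?J (add_monoid (poly_ring n))"
    proof (rule P.add.subgroupI)
      show "?J \<noteq> {}" using polys_closed(1)[of n] by (auto intro!: exI[of _ 0] simp: detector_0)
      show "\<ominus>\<^bsub>poly_ring n\<^esub> p \<in> ?J" if "p \<in> ?J" for p
      proof -
        have "\<ominus>\<^bsub>poly_ring n\<^esub> p = p" using that by (intro P.minus_equality) auto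
        thus ?thesis using that by simp
      qed
    qed (auto simp: polys_closed distrib_left detector_add simp del: add_bit_eq_xor)
  next
    fix p q assume pq: "p \<in> ?J" "q \<in> carrier (poly_ring n)"
    have "detector n k (r * (p * q)) = 0" if "r \<in> polys n" for r
    proof -
      have "detector n k ((r * q) * p) = 0" using that pq polys_closed(6)[of r n q] by simp
      thus ?thesis by (simp only: ac_simps)
    qed
    thus "p \<otimes>\<^bsub>poly_ring n\<^esub> q \<in> ?J" using pq polys_closed(6)[of p n q] by simp
    thus "q \<otimes>\<^bsub>poly_ring n\<^esub> p \<in> ?J" by (simp add: mult.commute)
  qed
  moreover have "{Var (VX i) ^ 2 + Var VTau * Var (VY i) | i. i \<in> {1..n}} \<subseteq> ?J"
  proof safe
    fix i assume "i \<in> {1..n}"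
    thus "Var (VX i) ^ 2 + Var VTau * Var (VY i) \<in> polys n" using rel_gens_polys by blast
  next
    fix i q
    have "q * (Var (VX i) ^ 2 + Var VTau * Var (VY i)) = q * Var (VX i) ^ 2 + (q * Var (VY i)) * Var VTau"
      by (simp add: algebra_simps)
    thus "detector n k (q * (Var (VX i) ^ 2 + Var VTau * Var (VY i))) = 0"
      by (simp only: detector_add detector_tau detector_x_square add_0)
  qed
  ultimately have "rel_ideal n \<subseteq> ?J"
    unfolding rel_ideal_def by (rule P.genideal_minimal)
  thus ?thesis using assms polys_closed(2)[of n] by force
qed

definition class_detector :: "nat \<Rightarrow> nat \<Rightarrow> mpoly set \<Rightarrow> bit" where
  "class_detector n k u = detector n k (SOME p. p \<in> polys n \<and> cls n p = u)"

text \<open>Two representatives differ by an element of the ideal, on which the functional vanishes,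
  so the choice of representative is immaterial.\<close>

lemma class_detector_cls:
  assumes "p \<in> polys n"
  shows "class_detector n k (cls n p) = detector n k p"
proof -
  define q where "q = (SOME q. q \<in> polys n \<and> cls n q = cls n p)"
  have q: "q \<in> polys n \<and> cls n q = cls n p"
    unfolding q_def by (rule someI[of _ p]) (simp add: assms)
  hence "detector n k (q + p) = 0" using assms cls_eq_iff[of q n p] detector_rel_ideal by metis
  hence "detector n k q = detector n k p"
    unfolding detector_add by (cases "detector n k q"; cases "detector n k p") auto
  thus ?thesis by (simp add: class_detector_def q_def)
qed

lemma class_detector_ops:
  assumes "u \<in> carrier (motivic_ring n)"
  shows "class_detector n k (tau n \<otimes>\<^bsub>motivic_ring n\<^esub> u) = 0"
    "k \<ge> 1 \<Longrightarrow> class_detector n k (Q0 n u) = 0"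
    "a \<ge> 1 \<Longrightarrow> class_detector n k (wp n a u) = 0"
proof -
  obtain p where p: "p \<in> polys n" "u = cls n p" using assms by (auto simp: carrier_motivic_ring)
  \<comment> \<open>By uniqueness the chosen operations agree on the carrier with the lifts of the
    explicit polynomial operations.\<close>
  note ops = motivic_operations_unique[OF motivic_operations_Q0_wp motivic_operations_exist assms]
  show "class_detector n k (tau n \<otimes>\<^bsub>motivic_ring n\<^esub> u) = 0"
    using p detector_tau[of n k p] by (simp add: class_detector_cls polys_closed mult.commute flip: cls_simps(3))
  show "k \<ge> 1 \<Longrightarrow> class_detector n k (Q0 n u) = 0" "a \<ge> 1 \<Longrightarrow> class_detector n k (wp n a u) = 0"
    unfolding ops using p by (simp_all add: lift_ops class_detector_cls op_closed detector_op)
qed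

lemma class_detector_add:
  assumes "u \<in> carrier (motivic_ring n)" "v \<in> carrier (motivic_ring n)"
  shows "class_detector n k (u \<oplus>\<^bsub>motivic_ring n\<^esub> v) = class_detector n k u + class_detector n k v"
proof -
  obtain p q where pq: "p \<in> polys n" "u = cls n p" "q \<in> polys n" "v = cls n q"
    using assms by (auto simp: carrier_motivic_ring)
  hence "u \<oplus>\<^bsub>motivic_ring n\<^esub> v = cls n (p + q)" by (simp add: cls_simps(2))
  thus ?thesis by (simp only: pq class_detector_cls polys_closed detector_add)
qed

lemma class_detector_zero: "class_detector n k \<zero>\<^bsub>motivic_ring n\<^esub> = 0"
  using class_detector_cls[OF polys_closed(1)] by (simp add: detector_0 cls_simps)

text \<open>The claim about degree 0 is there for compositions: when the outer factor has degree 0,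
  it only multiplies the functional by a scalar, and the inner factor has positive degree.\<close>

lemma class_detector_steenrod:
  assumes "steenrod n p q f" "k \<ge> 1"
  shows "(p + q > 0 \<longrightarrow> (\<forall>u\<in>carrier (motivic_ring n). class_detector n k (f u) = 0)) \<and>
    (p + q = 0 \<longrightarrow> (\<exists>c. \<forall>u\<in>carrier (motivic_ring n). class_detector n k (f u) = c * class_detector n k u))"
  using assms(1)
proof (induction rule: steenrod.induct)
  case one
  show ?case by (auto intro!: exI[of _ 1])
next
  case (zero p q)
  show ?case by (auto simp: class_detector_zero intro!: exI[of _ 0])
next
  case (add p q f g)
  note cl = steenrod_closed[OF add.hyps(1)] steenrod_closed[OF add.hyps(2)]
  show ?case
  proof (intro conjI impI)
    assume "p + q = 0"
    then obtain c c' where "\<forall>u\<in>carrier (motivic_ring n). class_detector n k (f u) = c * class_detector n k u"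
      "\<forall>u\<in>carrier (motivic_ring n). class_detector n k (g u) = c' * class_detector n k u" using add.IH by blast
    thus "\<exists>c. \<forall>u\<in>carrier (motivic_ring n). class_detector n k (f u \<oplus>\<^bsub>motivic_ring n\<^esub> g u) = c * class_detector n k u"
      by (intro exI[of _ "c + c'"]) (simp add: class_detector_add cl distrib_right del: add_bit_eq_xor mult_bit_eq_and)
  qed (use add.IH in \<open>simp add: class_detector_add cl\<close>)
next
  case (comp p q f p' q' g)
  note cl = steenrod_closed[OF comp.hyps(2)]
  show ?case
  proof (intro conjI impI)
    assume "p + p' + (q + q') = 0"
    hence "p + q = 0" "p' + q' = 0" by auto
    then obtain c c' where "\<forall>u\<in>carrier (motivic_ring n). class_detector n k (f u) = c * class_detector n k u"
      "\<forall>u\<in>carrier (motivic_ring n). class_detector n k (g u) = c' * class_detector n k u" using comp.IH by blast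
    thus "\<exists>c. \<forall>u\<in>carrier (motivic_ring n). class_detector n k (f (g u)) = c * class_detector n k u"
      by (intro exI[of _ "c * c'"]) (simp add: cl mult.assoc del: mult_bit_eq_and)
  next
    assume pos: "p + p' + (q + q') > 0"
    show "\<forall>u\<in>carrier (motivic_ring n). class_detector n k (f (g u)) = 0"
    proof (cases "p + q > 0")
      case True
      thus ?thesis using comp.IH(1) cl by blast
    next
      case False
      hence "p + q = 0" "p' + q' > 0" using pos by auto
      then obtain c where "\<forall>u\<in>carrier (motivic_ring n). class_detector n k (f u) = c * class_detector n k u"
        "\<forall>u\<in>carrier (motivic_ring n). class_detector n k (g u) = 0" using comp.IH by blast
      thus ?thesis using cl by simp
    qed
  qed
qed (use assms(2) in \<open>auto simp: class_detector_ops\<close>)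

text \<open>The only scalars are 0 and 1, so closure under scalar multiplication is
  automatic.\<close>

lemma F2_submoduleI:
  assumes "N \<subseteq> carrier (motivic_ring n)" "\<zero>\<^bsub>motivic_ring n\<^esub> \<in> N"
    and "\<And>u v. u \<in> N \<Longrightarrow> v \<in> N \<Longrightarrow> u \<oplus>\<^bsub>motivic_ring n\<^esub> v \<in> N"
  shows "submodule F2 N (motivic_ring n)"
proof -
  interpret A: algebra F2 "motivic_ring n" by (rule motivic_ring_algebra)
  show ?thesis
  proof (rule submodule.intro)
    show "module F2 (motivic_ring n)" ..
    fix c :: bit and v assume "v \<in> N"
    hence v: "v \<in> N" "v \<in> carrier (motivic_ring n)" using assms(1) by auto
    show "c \<odot>\<^bsub>motivic_ring n\<^esub> v \<in> N"
      using v A.smult_one[OF v(2)] A.smult_l_null[OF v(2)] assms(2) by (cases c) (simp_all)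
  qed (use assms in auto)
qed

lemma class_detector_hit:
  assumes "u \<in> hit n" "k \<ge> 1"
  shows "class_detector n k u = 0"
proof -
  interpret A: algebra F2 "motivic_ring n" by (rule motivic_ring_algebra)
  let ?N = "{u \<in> carrier (motivic_ring n). class_detector n k u = 0}"
  have "hit n \<subseteq> ?N"
    unfolding hit_def
  proof (rule A.span_is_subset)
    show "{f u | f u p q. steenrod n p q f \<and> p + q > 0 \<and> u \<in> carrier (motivic_ring n)} \<subseteq> ?N"
    proof
      fix v assume "v \<in> {f u | f u p q. steenrod n p q f \<and> p + q > 0 \<and> u \<in> carrier (motivic_ring n)}"
      then obtain f u p q where f: "steenrod n p q f" "p + q > 0"
        and u: "u \<in> carrier (motivic_ring n)" and v: "v = f u" by blast
      show "v \<in> ?N"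
        using class_detector_steenrod[OF f(1) assms(2), THEN conjunct1, THEN mp, OF f(2)] steenrod_closed[OF f(1) u] u
        by (simp add: v)
    qed
    show "submodule F2 ?N (motivic_ring n)"
      by (rule F2_submoduleI) (auto simp: class_detector_zero class_detector_add)
  qed
  thus ?thesis using assms(1) by blast
qed

section \<open>The dimension of the quotient\<close>

lemma degree_part_submodule: "submodule F2 (degree_part n d) (motivic_ring n)"
proof -
  interpret A: algebra F2 "motivic_ring n" by (rule motivic_ring_algebra)
  show ?thesis unfolding degree_part_def
    by (intro A.span_is_submodule) (auto simp: homog_def cls_simps)
qed

lemma hit_submodule: "submodule F2 (hit n) (motivic_ring n)"
proof -
  interpret A: algebra F2 "motivic_ring n" by (rule motivic_ring_algebra)
  show ?thesis unfolding hit_def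
    by (intro A.span_is_submodule) (auto intro: steenrod_closed)
qed

lemma homog_subset_degree_part: "homog n d w \<subseteq> degree_part n d"
proof -
  interpret A: algebra F2 "motivic_ring n" by (rule motivic_ring_algebra)
  have "(\<Union>w. homog n d w) \<subseteq> degree_part n d"
    unfolding degree_part_def by (intro A.in_own_span) (auto simp: homog_def cls_simps)
  thus ?thesis by blast
qed

text \<open>Multiples of \<open>tau\<close> thus vanish in the quotient, which reduces a spanning
  set to monomials without \<open>tau\<close>.\<close>

lemma tau_mult_hit:
  assumes "u \<in> carrier (motivic_ring n)"
  shows "tau n \<otimes>\<^bsub>motivic_ring n\<^esub> u \<in> hit n"
proof -
  interpret A: algebra F2 "motivic_ring n" by (rule motivic_ring_algebra)
  let ?S = "{f u | f u p q. steenrod n p q f \<and> p + q > 0 \<and> u \<in> carrier (motivic_ring n)}"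
  have "?S \<subseteq> hit n"
    unfolding hit_def by (intro A.in_own_span) (auto intro: steenrod_closed)
  moreover have "tau n \<otimes>\<^bsub>motivic_ring n\<^esub> u \<in> ?S"
    using steenrod.tau[of n] assms by fastforce
  ultimately show ?thesis by blast
qed

lemma fst_mono_bideg:
  assumes "Poly_Mapping.keys m \<subseteq> mvars n"
  shows "fst (mono_bideg m) = (\<Sum>i = 1..n. xexp m i) + 2 * ydeg n m"
proof -
  have "fst (mono_bideg m) = (\<Sum>v \<in> mvars n. Poly_Mapping.lookup m v * fst (var_bideg v))"
    unfolding mono_bideg_def fst_conv
    by (rule sum.mono_neutral_left) (use assms in \<open>auto simp: mvars_def in_keys_iff\<close>)
  also have "\<dots> = (\<Sum>v \<in> VX ` {1..n}. Poly_Mapping.lookup m v * fst (var_bideg v))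
      + (\<Sum>v \<in> VY ` {1..n}. Poly_Mapping.lookup m v * fst (var_bideg v))"
  proof -
    have "mvars n = insert VTau (VX ` {1..n} \<union> VY ` {1..n})" by (simp add: mvars_def)
    moreover have "VTau \<notin> VX ` {1..n} \<union> VY ` {1..n}" "VX ` {1..n} \<inter> VY ` {1..n} = {}" by auto
    ultimately show ?thesis by (simp add: sum.union_disjoint)
  qed
  finally show ?thesis
    by (simp add: sum.reindex inj_on_def ydeg_def sum_distrib_left mult.commute)
qed

text \<open>Every variable other than \<open>tau\<close> has positive first degree, so all exponents
  are at most \<open>d\<close>.\<close>

lemma finite_monos:
  "finite {m. Poly_Mapping.keys m \<subseteq> mvars n \<and> Poly_Mapping.lookup m VTau = 0 \<and> fst (mono_bideg m) = d}"
  (is "finite ?M")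
proof (rule finite_imageD[of Poly_Mapping.lookup])
  show "inj_on Poly_Mapping.lookup ?M"
    by (rule inj_onI) (simp only: lookup_inject)
  have le: "Poly_Mapping.lookup m v \<le> d" if m: "m \<in> ?M" for m v
  proof (cases "v \<in> Poly_Mapping.keys m")
    case True
    have "v \<noteq> VTau" using True m by (auto simp: in_keys_iff)
    hence "Poly_Mapping.lookup m v \<le> Poly_Mapping.lookup m v * fst (var_bideg v)" by (cases v) auto
    also have "\<dots> \<le> (\<Sum>v \<in> Poly_Mapping.keys m. Poly_Mapping.lookup m v * fst (var_bideg v))"
      using True by (intro member_le_sum) auto
    finally show ?thesis using m by (simp add: mono_bideg_def)
  qed (simp add: in_keys_iff)
  have zero: "Poly_Mapping.lookup m v = 0" if "m \<in> ?M" "v \<notin> mvars n" for m v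
  proof -
    have "v \<notin> Poly_Mapping.keys m" using that by blast
    thus ?thesis by (simp add: in_keys_iff)
  qed
  have "Poly_Mapping.lookup ` ?M \<subseteq> {f. \<forall>v. (v \<in> mvars n \<longrightarrow> f v \<in> {..d}) \<and> (v \<notin> mvars n \<longrightarrow> f v = 0)}"
  proof (rule image_subsetI)
    fix m assume "m \<in> ?M"
    thus "Poly_Mapping.lookup m \<in> {f. \<forall>v. (v \<in> mvars n \<longrightarrow> f v \<in> {..d}) \<and> (v \<notin> mvars n \<longrightarrow> f v = 0)}"
      using le[of m] zero[of m] by simp
  qed
  moreover have "finite (mvars n)" by (simp add: mvars_def)
  ultimately show "finite (Poly_Mapping.lookup ` ?M)"
    by (rule finite_subset[OF _ finite_set_of_finite_funs]) simp
qed

lemma submodule_abelian_subgroup: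
  assumes "vectorspace K V" "submodule K W V"
  shows "abelian_subgroup W V"
proof -
  interpret V: vectorspace K V by fact
  interpret W: submodule K W V by fact
  have "subgroup W (add_monoid V)"
  proof (rule V.add.subgroupI)
    fix w assume w: "w \<in> W"
    hence "\<ominus>\<^bsub>V\<^esub> w = (\<ominus>\<^bsub>K\<^esub> \<one>\<^bsub>K\<^esub>) \<odot>\<^bsub>V\<^esub> w"
      using W.subset V.smult_minus_1[of w] by (metis subsetD)
    thus "\<ominus>\<^bsub>V\<^esub> w \<in> W" using w W.smult_closed[of "\<ominus>\<^bsub>K\<^esub> \<one>\<^bsub>K\<^esub>" w] by simp
  next
    show "W \<noteq> {}" using W.zero_closed by blast
  qed (use W.subset in auto)
  thus ?thesis
    by (intro abelian_subgroupI3 additive_subgroup.intro V.abelian_group_axioms)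
qed

text \<open>\<open>dim\<close> is the least size of a finite spanning set. The set \<open>A\<close>
  guarantees that this minimum is attained; if it were 0, the empty set would span and the space
  would be zero.\<close>

lemma dim_neq_0:
  assumes "vectorspace K V" "finite A" "A \<subseteq> carrier V" "carrier V \<subseteq> LinearCombinations.module.span K V A"
    and "u \<in> carrier V" "u \<noteq> \<zero>\<^bsub>V\<^esub>"
  shows "vectorspace.dim K V \<noteq> 0"
proof
  interpret V: vectorspace K V by fact
  assume "V.dim = 0"
  have "\<exists>B. finite B \<and> card B = card A \<and> B \<subseteq> carrier V \<and> V.gen_set B"
    using assms V.span_is_subset2[OF assms(3)] by blast
  hence "\<exists>B. finite B \<and> card B = V.dim \<and> B \<subseteq> carrier V \<and> V.gen_set B"
    unfolding V.dim_def by (rule LeastI)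
  hence "V.span {} = carrier V" using \<open>V.dim = 0\<close> by auto
  moreover have "V.span {} = {\<zero>\<^bsub>V\<^esub>}" by (auto simp: V.span_def V.lincomb_def)
  ultimately show False using assms(5,6) by blast
qed

lemma detected_exists:
  assumes "k \<le> n"
  obtains m where "detected n k m" "Poly_Mapping.keys m \<subseteq> mvars n"
proof
  \<comment> \<open>The witness has x-factors at the indices 1 to \<open>k\<close>, with sigma(i) =
    i - 1.\<close>
  define y where "y i = (if i \<le> k then 2 ^ k - 1 - 2 ^ (i - 1) else 2 ^ k - 1 :: nat)" for i
  define m where "m = (\<Sum>i = 1..k. Poly_Mapping.single (VX i) (1 :: nat)) +
    (\<Sum>i = 1..n. Poly_Mapping.single (VY i) (y i))"
  have l: "Poly_Mapping.lookup m VTau = 0" "xexp m i = of_bool (i \<in> {1..k})"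
    "yexp m i = (if i \<in> {1..n} then y i else 0)" for i
    by (auto simp: m_def lookup_add lookup_sum lookup_single when_def)
  show "Poly_Mapping.keys m \<subseteq> mvars n"
  proof
    fix v assume "v \<in> Poly_Mapping.keys m"
    thus "v \<in> mvars n" using l assms by (cases v) (auto simp: in_keys_iff mvars_def split: if_splits)
  qed
  have I: "{i \<in> {1..n}. xexp m i = 1} = {1..k}" using assms by (auto simp: l)
  have "bij_betw (yexp m) {1..k} ((\<lambda>s. 2 ^ k - 1 - 2 ^ s) ` {..<k})"
    unfolding bij_betw_def
  proof
    have "yexp m ` {1..k} = (\<lambda>i. 2 ^ k - 1 - 2 ^ (i - 1)) ` {1..k}"
      using assms by (intro image_cong) (auto simp: l y_def)
    also have "\<dots> = (\<lambda>i. 2 ^ k - 1 - 2 ^ (i - 1)) ` Suc ` {..<k}"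
      by (simp add: lessThan_atLeast0 image_Suc_atLeastLessThan atLeastLessThanSuc_atLeastAtMost)
    also have "\<dots> = (\<lambda>s. 2 ^ k - 1 - 2 ^ s) ` {..<k}"
      by (simp add: image_image)
    finally show im: "yexp m ` {1..k} = (\<lambda>s. 2 ^ k - 1 - 2 ^ s) ` {..<k}" .
    \<comment> \<open>A map from \<open>k\<close> elements onto a set of \<open>k\<close> elements
      is injective.\<close>
    show "inj_on (yexp m) {1..k}"
      by (rule eq_card_imp_inj_on) (simp_all only: im card_full_minus_powers finite_atLeastAtMost card_atLeastAtMost diff_Suc_1)
  qed
  thus "detected n k m" unfolding detected_def I by (auto simp: reduced_def l y_def)
qed

text \<open>The x-factors contribute \<open>k\<close>, and the y-factors contribute twice the common
  y-degree (n - 1)(2^k - 1).\<close>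

lemma fst_mono_bideg_detected:
  assumes "detected n k m" "Poly_Mapping.keys m \<subseteq> mvars n" "n \<ge> 1"
  shows "fst (mono_bideg m) = (n - 1) * (2 ^ (k + 1) - 2) + k"
proof -
  have "xexp m i = of_bool (xexp m i = 1)" for i
  proof -
    have "xexp m i \<le> 1" using assms(1) by (simp add: detected_def reduced_def)
    thus ?thesis by (cases "xexp m i") auto
  qed
  hence "(\<Sum>i = 1..n. xexp m i) = (\<Sum>i = 1..n. of_bool (xexp m i = 1))" by (intro sum.cong) simp_all
  also have "\<dots> = card {i \<in> {1..n}. xexp m i = 1}" by (simp add: sum_of_bool_eq Int_def)
  also have "\<dots> = card ((\<lambda>s. 2 ^ k - 1 - 2 ^ s :: nat) ` {..<k})"
    by (rule bij_betw_same_card[of "yexp m"]) (use assms(1) in \<open>simp only: detected_def\<close>)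
  also have "\<dots> = k" by (rule card_full_minus_powers)
  finally have xexp: "(\<Sum>i = 1..n. xexp m i) = k" .
  obtain c where c: "n = Suc c" using assms(3) by (cases n) auto
  have "ydeg n m = c * (2 ^ k - 1)" using ydeg_detected[OF assms(1)] by (simp only: c mult_Suc)
  hence "fst (mono_bideg m) = k + c * (2 * (2 ^ k - 1))" unfolding fst_mono_bideg[OF assms(2)] xexp by simp
  also have "2 * (2 ^ k - 1) = (2 ^ (k + 1) - 2 :: nat)" by simp
  finally show ?thesis by (simp add: c)
qed

text \<open>The classes of the finitely many monomials without \<open>tau\<close> span the quotient,
  so its dimension is meaningful. The class of a detected monomial is nonzero, because the
  functional is 1 on it and 0 on all hit elements.\<close>

lemma QM_dim_neq_0:
  assumes "1 \<le> k" "k \<le> n" and d: "d = (n - 1) * (2 ^ (k + 1) - 2) + k"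
  shows "vectorspace.dim F2 (QM n d) \<noteq> 0"
proof -
  let ?M = "motivic_ring n" and ?D = "degree_part n d"
  let ?V = "?M\<lparr>carrier := ?D\<rparr>" and ?W = "hit n \<inter> ?D"
  interpret A: algebra F2 ?M by (rule motivic_ring_algebra)
  interpret D: submodule F2 ?D ?M by (rule degree_part_submodule)
  interpret H: submodule F2 "hit n" ?M by (rule hit_submodule)
  have V: "vectorspace F2 ?V"
    by (intro vectorspace.intro class_field A.submodule_is_module degree_part_submodule)
  have W: "submodule F2 ?W ?V"
    by (rule submodule.intro) (use A.submodule_is_module[OF degree_part_submodule] in auto)
  interpret V: vectorspace F2 ?V by (rule V)
  interpret W: submodule F2 ?W ?V by (rule W)
  interpret S: abelian_subgroup ?W ?V by (rule submodule_abelian_subgroup[OF V W])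
  interpret Q: vectorspace F2 "QM n d" by (rule QM_vectorspace)
  let ?c = "\<lambda>u. ?W +>\<^bsub>?V\<^esub> u"
  have carr: "carrier (QM n d) = ?c ` ?D"
    by (auto simp: QM_def quotient_module_def A_RCOSETS_def')
  have zero: "\<zero>\<^bsub>QM n d\<^esub> = ?W"
    by (simp add: QM_def quotient_module_def)
  have add: "?c (u \<oplus>\<^bsub>?M\<^esub> v) = ?c u \<oplus>\<^bsub>QM n d\<^esub> ?c v" if "u \<in> ?D" "v \<in> ?D" for u v
    using S.a_rcos_sum[of u v] that by (simp add: QM_def quotient_module_def)
  have const: "?c u = \<zero>\<^bsub>QM n d\<^esub>" if "u \<in> ?W" for u
    using S.a_rcos_const[OF that] by (simp add: zero)
  have monom_polys: "monom m \<in> polys n" if "Poly_Mapping.keys m \<subseteq> mvars n" for m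
    using that by (simp add: polys_def)

  let ?B = "{m. Poly_Mapping.keys m \<subseteq> mvars n \<and> Poly_Mapping.lookup m VTau = 0 \<and> fst (mono_bideg m) = d}"
  let ?G = "(\<lambda>m. ?c (cls n (monom m))) ` ?B"
  have monom_D: "cls n (monom m) \<in> ?D" if "Poly_Mapping.keys m \<subseteq> mvars n" "fst (mono_bideg m) = d" for m
  proof -
    have "cls n (monom m) \<in> homog n d (snd (mono_bideg m))"
      unfolding homog_def using that monom_polys by (intro imageI) (auto simp: prod_eq_iff)
    thus ?thesis using homog_subset_degree_part by blast
  qed
  have G: "?G \<subseteq> carrier (QM n d)" unfolding carr using monom_D by blast
  interpret Sp: submodule F2 "Q.span ?G" "QM n d" by (rule Q.span_is_submodule[OF G])
  \<comment> \<open>The elements whose class lies in the span form a subspace; it remains to see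
    that it contains every homogeneous element.\<close>
  let ?N = "{u \<in> ?D. ?c u \<in> Q.span ?G}"
  have N: "submodule F2 ?N ?M"
  proof (rule F2_submoduleI)
    show "?N \<subseteq> carrier ?M" using D.subset by blast
    have "?c \<zero>\<^bsub>?M\<^esub> = \<zero>\<^bsub>QM n d\<^esub>" by (rule const) simp
    thus "\<zero>\<^bsub>?M\<^esub> \<in> ?N" using Sp.zero_closed D.zero_closed by (metis (no_types, lifting) mem_Collect_eq)
    fix u v assume uv: "u \<in> ?N" "v \<in> ?N"
    hence "?c (u \<oplus>\<^bsub>?M\<^esub> v) \<in> Q.span ?G" using add[of u v] Sp.m_closed by (metis (no_types, lifting) mem_Collect_eq)
    thus "u \<oplus>\<^bsub>?M\<^esub> v \<in> ?N" using uv D.m_closed by blast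
  qed
  interpret N: submodule F2 ?N ?M by (rule N)
  have monom_N: "cls n (monom m) \<in> ?N" if m: "Poly_Mapping.keys m \<subseteq> mvars n" "fst (mono_bideg m) = d" for m
  proof (cases "Poly_Mapping.lookup m VTau = 0")
    case True
    hence "?c (cls n (monom m)) \<in> ?G" using m by blast
    hence "?c (cls n (monom m)) \<in> Q.span ?G" using Q.in_own_span[OF G] by blast
    thus ?thesis using monom_D[OF m] by blast
  next
    case False
    \<comment> \<open>A monomial divisible by \<open>tau\<close> is hit, so its class is
      zero.\<close>
    then obtain m' where m': "m = m' + Poly_Mapping.single VTau 1"
      by (elim mono_split[of 1 m VTau, rotated]) auto
    have "Poly_Mapping.keys m' \<subseteq> mvars n"
    proof
      fix v assume "v \<in> Poly_Mapping.keys m'"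
      hence "v \<in> Poly_Mapping.keys m" by (simp add: m' in_keys_iff lookup_add)
      thus "v \<in> mvars n" using m(1) by blast
    qed
    hence p: "monom m' \<in> polys n" by (rule monom_polys)
    have "cls n (monom m) = tau n \<otimes>\<^bsub>?M\<^esub> cls n (monom m')"
      unfolding m' monom_add_Var using p by (simp add: mult.commute[of "monom m'"] cls_simps(3))
    hence "cls n (monom m) \<in> hit n" using tau_mult_hit p cls_simps(1) by metis
    hence "?c (cls n (monom m)) = \<zero>\<^bsub>QM n d\<^esub>" using monom_D[OF m] by (intro const) blast
    thus ?thesis using monom_D[OF m] Sp.zero_closed by (metis (no_types, lifting) mem_Collect_eq)
  qed
  have sum_N: "cls n (\<Sum>m\<in>K. monom m) \<in> ?N"
    if "finite K" "\<And>m. m \<in> K \<Longrightarrow> Poly_Mapping.keys m \<subseteq> mvars n \<and> fst (mono_bideg m) = d" for K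
    using that
  proof (induction K rule: finite_induct)
    case empty
    show ?case unfolding sum.empty cls_simps(5) by (rule N.zero_closed)
  next
    case (insert m K)
    have eq: "cls n (\<Sum>m\<in>insert m K. monom m) = cls n (monom m) \<oplus>\<^bsub>?M\<^esub> cls n (\<Sum>m\<in>K. monom m)"
      using insert by (simp add: cls_simps(2) monom_polys polys_sum)
    have "cls n (monom m) \<in> ?N" using insert.prems[of m] by (intro monom_N) auto
    moreover have "cls n (\<Sum>m\<in>K. monom m) \<in> ?N" by (rule insert.IH) (rule insert.prems, rule insertI2)
    ultimately show ?case unfolding eq by (rule N.m_closed)
  qed
  have "(\<Union>w. homog n d w) \<subseteq> ?N"
  proof
    fix u assume "u \<in> (\<Union>w. homog n d w)"
    then obtain w p where p: "p \<in> polys n" "\<forall>m \<in> Poly_Mapping.keys p. mono_bideg m = (d, w)" "u = cls n p"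
      by (auto simp: homog_def)
    have "cls n (\<Sum>m\<in>Poly_Mapping.keys p. monom m) \<in> ?N"
      using p by (intro sum_N) (auto simp: polys_def)
    thus "u \<in> ?N" unfolding mpoly_eq_sum[of p, symmetric] p(3) .
  qed
  hence "?D \<subseteq> ?N"
    using A.span_is_subset[OF _ N] by (simp only: degree_part_def)
  hence span: "carrier (QM n d) \<subseteq> Q.span ?G" unfolding carr by blast

  obtain m where m: "detected n k m" "Poly_Mapping.keys m \<subseteq> mvars n" using detected_exists assms(2) by blast
  have md: "fst (mono_bideg m) = d" using fst_mono_bideg_detected[OF m] assms by simp
  let ?u = "cls n (monom m)"
  have "class_detector n k ?u = 1" using m by (simp add: class_detector_cls monom_polys detector_monom)
  hence "?u \<notin> hit n" using class_detector_hit assms(1) by fastforce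
  moreover have "?u \<in> ?c ?u" using S.a_rcos_self[of ?u] monom_D[OF m(2) md] by simp
  ultimately have "?c ?u \<noteq> \<zero>\<^bsub>QM n d\<^esub>" unfolding zero by blast
  moreover have "?c ?u \<in> carrier (QM n d)" unfolding carr using monom_D[OF m(2) md] by blast
  ultimately show ?thesis
    using dim_neq_0[OF QM_vectorspace _ G span] finite_monos by blast
qed

theorem theorem1p3:
  fixes n k d :: nat
  assumes "n > 0" and "alpha (n - 2) \<ge> 3"
    and "k = n - 3" and "d = (n - 1) * (2 ^ (k + 1) - 2) + k"
  shows "beta d > n \<and> vectorspace.dim F2 (QM n d) \<noteq> 0"
proof
  show "beta d > n" using assms(2-4) by (rule less_beta)
  have "k \<ge> 1"
  proof (rule ccontr)
    assume "\<not> k \<ge> 1"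
    hence "n - 2 \<le> 1" using assms(3) by simp
    thus False using assms(2) alpha_le[of "n - 2"] by simp
  qed
  thus "vectorspace.dim F2 (QM n d) \<noteq> 0" using assms(3,4) by (intro QM_dim_neq_0[of k]) auto
qed

end
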